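(* Let $\mathcal M$ be a smooth manifold endowed with a nondegenerate smooth $(0,2)$-tensor field $\tau$, let $\check{\mathcal M}$ be a smooth manifold, let $\varphi\in C^\infty(\check{\mathcal M},\mathcal M)$ be a smooth embedding such that the reduced tensor field $\check\tau:=\varphi^*\tau$ is nondegenerate, and let $\varrho\in C^\infty(\mathcal M,\check{\mathcal M})$ be a point reduction for $\varphi$. Then the generalized manifold Galerkin (GMG) reduction $$R_{\mathrm{GMG}}:E_{\varphi(\check{\mathcal M})}\to T\check{\mathcal M},\qquad (m,v)\mapsto\Big(\varrho(m),\ \big(\sharp_{\check\tau}\circ\mathrm d\varphi^*|_{\varrho(m)}\circ\flat_\tau\big)(v)\Big)$$ is a reduction map for $\varphi$ (on the domain $E_{\varphi(\check{\mathcal M})}$).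
   Context: A smooth embedding is a smooth immersion that is a homeomorphism onto its image; a point reduction for $\varphi$ is a map $\varrho\in C^\infty(\mathcal M,\check{\mathcal M})$ with $\varrho\circ\varphi=\mathrm{id}_{\check{\mathcal M}}$. A $(0,2)$-tensor field $\tau$ (not necessarily symmetric or skew-symmetric) is nondegenerate if its coordinate matrix $(\tau|_m)_{ij}$ is invertible at each point. The pullback is $(\varphi^*\tau)|_{\check m}(\check v,\check w)=\tau|_{\varphi(\check m)}(\mathrm d\varphi|_{\check m}\check v,\mathrm d\varphi|_{\check m}\check w)$. For nondegenerate $\tau$, the musical isomorphism $\flat_\tau:T_m\mathcal M\to T_m^*\mathcal M$ is given in a chart by $(\flat_\tau v)_i=\sum_j(\tau|_m)_{ij}v^j$, and $\sharp_\tau:T_m^*\mathcal M\to T_m\mathcal M$ is its inverse, $(\sharp_\tau\lambda)^i=\sum_j(\tau|_m)^{ij}\lambda_j$, where $((\tau|_m)^{ij})$ is the inverse matrix of $((\tau|_m)_{ij})$; analogously for $\check\tau$ on $\check{\mathcal M}$. The map $\mathrm d\varphi^*|_{\check m}:T^*_{\varphi(\check m)}\mathcal M\to T^*_{\check m}\check{\mathcal M}$ is the pointwise pullback of covectors, $\lambda\mapsto\lambda\circ\mathrm d\varphi|_{\check m}$. $E_{\varphi(\check{\mathcal M})}:=\dot\bigcup_{m\in\varphi(\check{\mathcal M})}T_m\mathcal M\subseteq T\mathcal M$ is the restriction of the tangent bundle of $\mathcal M$ to the embedded submanifold $\varphi(\check{\mathcal M})$. A reduction map for $\varphi$ on the domain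 $E_{\varphi(\check{\mathcal M})}$ is a smooth map $R:E_{\varphi(\check{\mathcal M})}\to T\check{\mathcal M}$ of the form $R(m,v)=(\varrho(m),R|_m(v))$, with $\varrho$ mapping into $\check{\mathcal M}$ and $R|_m:T_m\mathcal M\to T_{\varrho(m)}\check{\mathcal M}$, satisfying the projection property $R\circ\mathrm d\varphi=\mathrm{id}_{T\check{\mathcal M}}$, where $\mathrm d\varphi(\check m,\check v)=(\varphi(\check m),\mathrm d\varphi|_{\check m}(\check v))$. *)

theory Defs
  imports "HOL-Analysis.Analysis"
begin

section \<open>Model spaces\<close>

text \<open>
  The model spaces \<open>R\<^sup>n\<close> of manifolds: the class \<^class>\<open>euclidean_space\<close> without the axiom that the
  standard basis is nonempty, so that \<open>n = 0\<close> is included. The elements of \<open>Axes\<close> are the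
  standard basis vectors, and \<open>x \<bullet> i\<close> for \<open>i \<in> Axes\<close> is the \<open>i\<close>-th coordinate of \<open>x\<close>.
\<close>

class cartesian_space = real_inner +
  fixes Axes :: "'a set"
  assumes finite_Axes: "finite Axes"
    and inner_Axes: "\<lbrakk>u \<in> Axes; v \<in> Axes\<rbrakk> \<Longrightarrow> inner u v = (if u = v then 1 else 0)"
    and Axes_all_zero_iff: "(\<forall>u\<in>Axes. inner x u = 0) \<longleftrightarrow> x = 0"

lemma zero_notin_Axes: "0 \<notin> Axes"
  using inner_Axes[of 0 0] by auto

text \<open>The instances \<^typ>\<open>unit\<close>, \<^typ>\<open>real\<close> and products provide \<open>R\<^sup>n\<close> for every \<open>n \<ge> 0\<close>.\<close>

instantiation real :: cartesian_space
begin
definition Axes_real :: "real set" where "Axes_real = {1}"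
instance by standard (auto simp: Axes_real_def)
end

instantiation prod :: (cartesian_space, cartesian_space) cartesian_space
begin
definition Axes_prod :: "('a \<times> 'b) set"
  where "Axes_prod = (\<lambda>u. (u, 0)) ` Axes \<union> (\<lambda>v. (0, v)) ` Axes"
instance
proof
  show "finite (Axes :: ('a \<times> 'b) set)"
    by (simp add: Axes_prod_def finite_Axes)
next
  fix u v :: "'a \<times> 'b"
  assume "u \<in> Axes" "v \<in> Axes"
  then show "inner u v = (if u = v then 1 else 0)"
    by (auto simp: Axes_prod_def inner_Axes zero_notin_Axes split: if_split_asm)
next
  fix x :: "'a \<times> 'b"
  show "(\<forall>u\<in>Axes. inner x u = 0) \<longleftrightarrow> x = 0"
    unfolding Axes_prod_def ball_Un ball_simps
    by (simp add: inner_prod_def prod_eq_iff Axes_all_zero_iff)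
qed
end

instantiation unit :: cartesian_space
begin
definition zero_unit :: unit where "zero_unit = ()"
definition plus_unit :: "unit \<Rightarrow> unit \<Rightarrow> unit" where "plus_unit x y = ()"
definition scaleR_unit :: "real \<Rightarrow> unit \<Rightarrow> unit" where "scaleR_unit a x = ()"
definition norm_unit :: "unit \<Rightarrow> real" where "norm_unit x = 0"
definition dist_unit :: "unit \<Rightarrow> unit \<Rightarrow> real" where "dist_unit x y = 0"
definition sgn_unit :: "unit \<Rightarrow> unit" where "sgn_unit x = ()"
definition inner_unit :: "unit \<Rightarrow> unit \<Rightarrow> real" where "inner_unit x y = 0"
definition Axes_unit :: "unit set" where "Axes_unit = {}"
definition uniformity_unit :: "(unit \<times> unit) filter"
  where "uniformity_unit = (INF e\<in>{0 <..}. principal {(x, y). dist x y < e})"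
definition open_unit :: "unit set \<Rightarrow> bool"
  where "open_unit U \<longleftrightarrow> (\<forall>x\<in>U. eventually (\<lambda>(x', y). x' = x \<longrightarrow> y \<in> U) uniformity)"
instance
  by standard
    (simp_all add: uniformity_unit_def open_unit_def Axes_unit_def
      norm_unit_def dist_unit_def inner_unit_def)
end

section \<open>Smooth maps between open subsets of model spaces\<close>

text \<open>
  \<open>Ck_on k f S\<close> is \<open>C\<^sup>k\<close>-regularity for \<^emph>\<open>open\<close> \<open>S\<close>: the directional derivatives
  \<open>x \<mapsto> Df(x) v\<close> of a differentiable \<open>f\<close> are \<open>C\<^sup>k\<^sup>-\<^sup>1\<close> for every fixed vector \<open>v\<close>. The domain is
  finite-dimensional in all uses below, so this is the usual notion.
\<close>

primrec Ck_on :: "nat \<Rightarrow> ('e::real_normed_vector \<Rightarrow> 'f::real_normed_vector) \<Rightarrow> 'e set \<Rightarrow> bool" where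
  "Ck_on 0 f S \<longleftrightarrow> continuous_on S f"
| "Ck_on (Suc k) f S \<longleftrightarrow>
     (\<forall>x\<in>S. f differentiable (at x)) \<and>
     (\<forall>v. Ck_on k (\<lambda>x. frechet_derivative f (at x) v) S)"

definition smooth_on :: "('e::real_normed_vector \<Rightarrow> 'f::real_normed_vector) \<Rightarrow> 'e set \<Rightarrow> bool"
  where "smooth_on f S \<longleftrightarrow> (\<forall>k. Ck_on k f S)"

section \<open>Smooth manifolds and smooth maps\<close>

text \<open>
  A chart is a pair of its domain and a coordinate map; the values of the coordinate map outside
  the domain are irrelevant. The atlas of a manifold need not be maximal: it represents the smooth
  structure that it generates.
\<close>

type_synonym ('a, 'e) chart = "'a set \<times> ('a \<Rightarrow> 'e)"

record ('a, 'e) manifold =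
  mtop :: "'a topology"
  atlas :: "('a, 'e) chart set"

abbreviation points :: "('a, 'e, 'z) manifold_scheme \<Rightarrow> 'a set"
  where "points M \<equiv> topspace (mtop M)"

definition chart_inv :: "('a, 'e) chart \<Rightarrow> 'e \<Rightarrow> 'a"
  where "chart_inv c = inv_into (fst c) (snd c)"

text \<open>The coordinate representation of \<open>f\<close> with respect to charts of its domain and codomain.\<close>

definition chart_rep :: "('a, 'e) chart \<Rightarrow> ('a \<Rightarrow> 'b) \<Rightarrow> ('b, 'f) chart \<Rightarrow> 'e \<Rightarrow> 'f"
  where "chart_rep c f d = snd d \<circ> f \<circ> chart_inv c"

abbreviation transition :: "('a, 'e) chart \<Rightarrow> ('a, 'e) chart \<Rightarrow> 'e \<Rightarrow> 'e"
  where "transition c c' \<equiv> chart_rep c (\<lambda>m. m) c'"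

definition smooth_manifold :: "('a, 'e::cartesian_space) manifold \<Rightarrow> bool" where
  "smooth_manifold M \<longleftrightarrow>
     Hausdorff_space (mtop M) \<and> second_countable (mtop M) \<and>
     (\<Union>c\<in>atlas M. fst c) = points M \<and>
     (\<forall>c\<in>atlas M. openin (mtop M) (fst c) \<and> open (snd c ` fst c) \<and>
        homeomorphic_map (subtopology (mtop M) (fst c)) (top_of_set (snd c ` fst c)) (snd c)) \<and>
     (\<forall>c\<in>atlas M. \<forall>c'\<in>atlas M. smooth_on (transition c c') (snd c ` (fst c \<inter> fst c')))"

definition charts_at :: "('a, 'e) manifold \<Rightarrow> 'a \<Rightarrow> ('a, 'e) chart set"
  where "charts_at M m = {c \<in> atlas M. m \<in> fst c}"

text \<open>
  An arbitrary chart around \<open>m\<close>. The notions defined below through this choice do not depend on it.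
\<close>

definition some_chart :: "('a, 'e) manifold \<Rightarrow> 'a \<Rightarrow> ('a, 'e) chart"
  where "some_chart M m = (SOME c. c \<in> charts_at M m)"

definition smooth_map ::
  "('a, 'e::cartesian_space) manifold \<Rightarrow> ('b, 'f::cartesian_space) manifold \<Rightarrow> ('a \<Rightarrow> 'b) \<Rightarrow> bool"
  where
  "smooth_map M N f \<longleftrightarrow>
     continuous_map (mtop M) (mtop N) f \<and>
     (\<forall>c\<in>atlas M. \<forall>d\<in>atlas N. smooth_on (chart_rep c f d) (snd c ` (fst c \<inter> f -` fst d)))"

section \<open>Tangent spaces and the tangent bundle\<close>

text \<open>
  A tangent vector at \<open>m\<close> is the family of its coordinate vectors in the charts around \<open>m\<close>, which
  transform by the derivative of the transition maps. The entries for all other charts are set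
  to \<open>0\<close>. The vector space operations are pointwise.
\<close>

type_synonym ('a, 'e) tvec = "('a, 'e) chart \<Rightarrow> 'e"

definition tangent_space :: "('a, 'e::cartesian_space) manifold \<Rightarrow> 'a \<Rightarrow> ('a, 'e) tvec set" where
  "tangent_space M m =
     {v. (\<forall>c\<in>charts_at M m. \<forall>c'\<in>charts_at M m.
            v c' = frechet_derivative (transition c c') (at (snd c m)) (v c)) \<and>
         (\<forall>c. c \<notin> charts_at M m \<longrightarrow> v c = 0)}"

text \<open>
  The tangent vector at \<open>m\<close> whose coordinate vector in the chart \<open>c\<close> is \<open>x\<close>. In particular,
  \<open>tvec_of M c m i\<close> for \<open>i \<in> Axes\<close> is the \<open>i\<close>-th coordinate vector field of \<open>c\<close> at \<open>m\<close>.
\<close>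

definition tvec_of ::
  "('a, 'e::cartesian_space) manifold \<Rightarrow> ('a, 'e) chart \<Rightarrow> 'a \<Rightarrow> 'e \<Rightarrow> ('a, 'e) tvec" where
  "tvec_of M c m x =
     (\<lambda>c'. if c' \<in> charts_at M m
           then frechet_derivative (transition c c') (at (snd c m)) x else 0)"

definition differential ::
  "('a, 'e::cartesian_space) manifold \<Rightarrow> ('b, 'f::cartesian_space) manifold \<Rightarrow> ('a \<Rightarrow> 'b) \<Rightarrow>
   'a \<Rightarrow> ('a, 'e) tvec \<Rightarrow> ('b, 'f) tvec" where
  "differential M N f m v =
     (let c = some_chart M m in
      (\<lambda>d. if d \<in> charts_at N (f m)
           then frechet_derivative (chart_rep c f d) (at (snd c m)) (v c) else 0))"

definition tangent_map ::
  "('a, 'e::cartesian_space) manifold \<Rightarrow> ('b, 'f::cartesian_space) manifold \<Rightarrow> ('a \<Rightarrow> 'b) \<Rightarrow>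
   'a \<times> ('a, 'e) tvec \<Rightarrow> 'b \<times> ('b, 'f) tvec" where
  "tangent_map M N f = (\<lambda>(m, v). (f m, differential M N f m v))"

definition tangent_chart ::
  "('a, 'e::cartesian_space) manifold \<Rightarrow> ('a, 'e) chart \<Rightarrow> ('a \<times> ('a, 'e) tvec, 'e \<times> 'e) chart" where
  "tangent_chart M c =
     (Sigma (fst c) (tangent_space M), \<lambda>(m, v). (snd c m, v c))"

text \<open>The topology of \<open>TM\<close> is the one for which all charts of \<open>TM\<close> are homeomorphisms.\<close>

definition tangent_bundle ::
  "('a, 'e::cartesian_space) manifold \<Rightarrow> ('a \<times> ('a, 'e) tvec, 'e \<times> 'e) manifold" where
  "tangent_bundle M =
     (let A = tangent_chart M ` atlas M in
      \<lparr> mtop = topology_generated_by {{p \<in> fst k. snd k p \<in> W} | k W. k \<in> A \<and> open W},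
        atlas = A \<rparr>)"

section \<open>Embeddings and the restricted tangent bundle\<close>

definition immersion ::
  "('a, 'e::cartesian_space) manifold \<Rightarrow> ('b, 'f::cartesian_space) manifold \<Rightarrow> ('a \<Rightarrow> 'b) \<Rightarrow> bool" where
  "immersion M N f \<longleftrightarrow>
     smooth_map M N f \<and>
     (\<forall>m\<in>points M. inj_on (differential M N f m) (tangent_space M m))"

definition smooth_embedding ::
  "('a, 'e::cartesian_space) manifold \<Rightarrow> ('b, 'f::cartesian_space) manifold \<Rightarrow> ('a \<Rightarrow> 'b) \<Rightarrow> bool" where
  "smooth_embedding M N f \<longleftrightarrow> immersion M N f \<and> embedding_map (mtop M) (mtop N) f"

text \<open>
  The image of an embedding \<open>\<phi>\<close> of \<open>N\<close> into \<open>M\<close> as an embedded submanifold of \<open>M\<close>: it carries the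
  subspace topology and the smooth structure for which \<open>\<phi>\<close> is a diffeomorphism onto it.
\<close>

definition embedded_image ::
  "('b, 'f) manifold \<Rightarrow> ('a, 'e) manifold \<Rightarrow> ('b \<Rightarrow> 'a) \<Rightarrow> ('a, 'f) manifold" where
  "embedded_image N M \<phi> =
     \<lparr> mtop = subtopology (mtop M) (\<phi> ` points N),
       atlas = (\<lambda>d. (\<phi> ` fst d, snd d \<circ> inv_into (points N) \<phi>)) ` atlas N \<rparr>"

text \<open>
  The restriction of \<open>TM\<close> to an embedded submanifold \<open>S\<close> of \<open>M\<close>, as a subset of \<open>TM\<close>. Its charts
  combine a chart \<open>s\<close> of \<open>S\<close> for the base point with a chart \<open>c\<close> of \<open>M\<close> for the (unrestricted)
  tangent vector of \<open>M\<close>.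
\<close>

definition restricted_tangent_bundle ::
  "('a, 'e::cartesian_space) manifold \<Rightarrow> ('a, 'f::cartesian_space) manifold \<Rightarrow>
   ('a \<times> ('a, 'e) tvec, 'f \<times> 'e) manifold" where
  "restricted_tangent_bundle M S =
     \<lparr> mtop = subtopology (mtop (tangent_bundle M)) (Sigma (points S) (tangent_space M)),
       atlas = {(Sigma (fst s \<inter> fst c) (tangent_space M), \<lambda>(m, v). (snd s m, v c)) | s c.
                  s \<in> atlas S \<and> c \<in> atlas M} \<rparr>"

section \<open>Tensor fields and musical isomorphisms\<close>

text \<open>A \<open>(0,2)\<close>-tensor field; only its values on tangent vectors at points of \<open>M\<close> matter.\<close>

type_synonym ('a, 'e) tensor02 = "'a \<Rightarrow> ('a, 'e) tvec \<Rightarrow> ('a, 'e) tvec \<Rightarrow> real"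

definition tensor_coord ::
  "('a, 'e::cartesian_space) manifold \<Rightarrow> ('a, 'e) tensor02 \<Rightarrow> ('a, 'e) chart \<Rightarrow> 'a \<Rightarrow> 'e \<Rightarrow> 'e \<Rightarrow> real" where
  "tensor_coord M \<tau> c m i j = \<tau> m (tvec_of M c m i) (tvec_of M c m j)"

definition smooth_tensor_field ::
  "('a, 'e::cartesian_space) manifold \<Rightarrow> ('a, 'e) tensor02 \<Rightarrow> bool" where
  "smooth_tensor_field M \<tau> \<longleftrightarrow>
     (\<forall>m\<in>points M. \<forall>u\<in>tangent_space M m. \<forall>v\<in>tangent_space M m. \<forall>w\<in>tangent_space M m. \<forall>a.
        \<tau> m (\<lambda>c. a *\<^sub>R u c + v c) w = a * \<tau> m u w + \<tau> m v w \<and>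
        \<tau> m w (\<lambda>c. a *\<^sub>R u c + v c) = a * \<tau> m w u + \<tau> m w v) \<and>
     (\<forall>c\<in>atlas M. \<forall>i\<in>Axes. \<forall>j\<in>Axes.
        smooth_on (\<lambda>x. tensor_coord M \<tau> c (chart_inv c x) i j) (snd c ` fst c))"

text \<open>Square matrices with rows and columns indexed by \<open>Axes\<close>.\<close>

definition inverse_matrices :: "('e::cartesian_space \<Rightarrow> 'e \<Rightarrow> real) \<Rightarrow> ('e \<Rightarrow> 'e \<Rightarrow> real) \<Rightarrow> bool" where
  "inverse_matrices A B \<longleftrightarrow>
     (\<forall>i\<in>Axes. \<forall>k\<in>Axes.
        (\<Sum>j\<in>Axes. A i j * B j k) = (if i = k then 1 else 0) \<and>
        (\<Sum>j\<in>Axes. B i j * A j k) = (if i = k then 1 else 0))"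

definition mat_inverse :: "('e::cartesian_space \<Rightarrow> 'e \<Rightarrow> real) \<Rightarrow> 'e \<Rightarrow> 'e \<Rightarrow> real"
  where "mat_inverse A = (SOME B. inverse_matrices A B)"

definition nondegenerate ::
  "('a, 'e::cartesian_space) manifold \<Rightarrow> ('a, 'e) tensor02 \<Rightarrow> bool" where
  "nondegenerate M \<tau> \<longleftrightarrow>
     (\<forall>m\<in>points M. \<forall>c\<in>charts_at M m. \<exists>B. inverse_matrices (tensor_coord M \<tau> c m) B)"

definition pullback_tensor ::
  "('b, 'f::cartesian_space) manifold \<Rightarrow> ('a, 'e::cartesian_space) manifold \<Rightarrow> ('b \<Rightarrow> 'a) \<Rightarrow>
   ('a, 'e) tensor02 \<Rightarrow> ('b, 'f) tensor02" where
  "pullback_tensor N M \<phi> \<tau> n v w =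
     \<tau> (\<phi> n) (differential N M \<phi> n v) (differential N M \<phi> n w)"

text \<open>
  A covector at \<open>m\<close> is a linear form on the tangent space at \<open>m\<close>, extended by \<open>undefined\<close> to all
  families. Its components in the chart \<open>c\<close> are its values on the coordinate vectors
  \<open>tvec_of M c m i\<close>; the components of a tangent vector \<open>v\<close> are \<open>v c \<bullet> i\<close>.
\<close>

type_synonym ('a, 'e) covec = "('a, 'e) tvec \<Rightarrow> real"

definition flat ::
  "('a, 'e::cartesian_space) manifold \<Rightarrow> ('a, 'e) tensor02 \<Rightarrow> 'a \<Rightarrow> ('a, 'e) tvec \<Rightarrow> ('a, 'e) covec" where
  "flat M \<tau> m v =
     (let c = some_chart M m in
      (\<lambda>w\<in>tangent_space M m.
        \<Sum>i\<in>Axes. (\<Sum>j\<in>Axes. tensor_coord M \<tau> c m i j * (v c \<bullet> j)) * (w c \<bullet> i)))"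

definition sharp ::
  "('a, 'e::cartesian_space) manifold \<Rightarrow> ('a, 'e) tensor02 \<Rightarrow> 'a \<Rightarrow> ('a, 'e) covec \<Rightarrow> ('a, 'e) tvec" where
  "sharp M \<tau> m l =
     (let c = some_chart M m in
      tvec_of M c m
        (\<Sum>i\<in>Axes. (\<Sum>j\<in>Axes. mat_inverse (tensor_coord M \<tau> c m) i j * l (tvec_of M c m j)) *\<^sub>R i))"

definition pullback_covec ::
  "('b, 'f::cartesian_space) manifold \<Rightarrow> ('a, 'e::cartesian_space) manifold \<Rightarrow> ('b \<Rightarrow> 'a) \<Rightarrow>
   'b \<Rightarrow> ('a, 'e) covec \<Rightarrow> ('b, 'f) covec" where
  "pullback_covec N M \<phi> n l = (\<lambda>v\<in>tangent_space N n. l (differential N M \<phi> n v))"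

section \<open>Reduction maps\<close>

definition point_reduction ::
  "('b, 'f::cartesian_space) manifold \<Rightarrow> ('a, 'e::cartesian_space) manifold \<Rightarrow> ('b \<Rightarrow> 'a) \<Rightarrow>
   ('a \<Rightarrow> 'b) \<Rightarrow> bool" where
  "point_reduction N M \<phi> \<rho> \<longleftrightarrow> smooth_map M N \<rho> \<and> (\<forall>n\<in>points N. \<rho> (\<phi> n) = n)"

definition reduction_map ::
  "('b, 'f::cartesian_space) manifold \<Rightarrow> ('a, 'e::cartesian_space) manifold \<Rightarrow> ('b \<Rightarrow> 'a) \<Rightarrow>
   ('a \<times> ('a, 'e) tvec \<Rightarrow> 'b \<times> ('b, 'f) tvec) \<Rightarrow> bool" where
  "reduction_map N M \<phi> R \<longleftrightarrow>
     smooth_map (restricted_tangent_bundle M (embedded_image N M \<phi>)) (tangent_bundle N) R \<and>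
     (\<exists>\<rho> r. \<forall>m\<in>\<phi> ` points N. \<rho> m \<in> points N \<and>
        (\<forall>v\<in>tangent_space M m. r m v \<in> tangent_space N (\<rho> m) \<and> R (m, v) = (\<rho> m, r m v))) \<and>
     (\<forall>p\<in>Sigma (points N) (tangent_space N). R (tangent_map N M \<phi> p) = p)"

definition gmg_reduction ::
  "('b, 'f::cartesian_space) manifold \<Rightarrow> ('a, 'e::cartesian_space) manifold \<Rightarrow> ('b \<Rightarrow> 'a) \<Rightarrow>
   ('a, 'e) tensor02 \<Rightarrow> ('a \<Rightarrow> 'b) \<Rightarrow> 'a \<times> ('a, 'e) tvec \<Rightarrow> 'b \<times> ('b, 'f) tvec" where
  "gmg_reduction N M \<phi> \<tau> \<rho> =
     (\<lambda>(m, v). (\<rho> m,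
        (sharp N (pullback_tensor N M \<phi> \<tau>) (\<rho> m) \<circ> pullback_covec N M \<phi> (\<rho> m) \<circ> flat M \<tau> m) v))"

end

theory Submission
  imports Defs
begin

text \<open>
  Why the theorem holds. By bilinearity, \<open>flat M \<tau> m v\<close> is the form \<open>u \<mapsto> \<tau>(u, v)\<close> whatever chart it is
  computed in. At \<open>m = \<phi>(n)\<close> the pulled back covector is \<open>u \<mapsto> \<tau>(d\<phi> u, v)\<close>. Nondegeneracy of the
  reduced tensor \<open>\<tau>' = \<phi>\<^sup>*\<tau>\<close> says that every linear form \<open>l\<close> on \<open>T\<^sub>nN\<close> is \<open>\<tau>'(\<cdot>, w)\<close> for exactly one
  \<open>w\<close>, and \<open>\<sharp>l\<close> is this \<open>w\<close> (\<open>sharp_represents\<close>, \<open>represented_coords\<close>). Hence the reduction of \<open>v\<close> is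
  the Galerkin solution: the unique \<open>w \<in> T\<^sub>nN\<close> with \<open>\<tau>(d\<phi> u, d\<phi> w) = \<tau>(d\<phi> u, v)\<close> for all \<open>u \<in> T\<^sub>nN\<close>.
  For \<open>v = d\<phi> w\<^sub>0\<close> the vector \<open>w\<^sub>0\<close> is such a solution, which is the projection property.

  The characterization makes no reference to charts. This matters for smoothness, because \<open>flat\<close>,
  \<open>sharp\<close> and \<open>differential\<close> are computed in a chart that is picked separately at every point, with no
  regularity in the point. Fix instead one chart \<open>d\<close> of \<open>N\<close> and one chart \<open>c\<close> of \<open>M\<close>. The unique
  solution then has the coordinates
  \[ w_i = \sum_j B_{ij}(y) \sum_{k,l} \partial_j \phi_k(y)\, x_l\, \tau_{kl}(\phi(y)), \]
  where \<open>B\<close> is the inverse of the matrix of \<open>\<tau>'\<close> (\<open>reduced_rep_chart\<close>). Everything on the right is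
  smooth in \<open>(y, x)\<close> by the rules for products and compositions, except that the entries of an inverse
  matrix need an argument of their own (\<open>smooth_on_matrix_inverse\<close>).

  Smoothness of the reduction includes continuity for the subspace topology of \<open>TM\<close>, although the
  coordinates used above are those of \<open>N\<close>. The point reduction bridges the gap: the base coordinate
  \<open>y\<close> is recovered continuously from \<open>m\<close> as the coordinate of \<open>\<rho>(m)\<close>, so that preimages of open
  sets extend to open subsets of \<open>TM\<close> (\<open>continuous_R\<close>).
\<close>

section \<open>Calculus of maps of class \<open>C\<^sup>k\<close>\<close>

lemma frechet_derivative_eqI:
  "(f has_derivative f') (at x) \<Longrightarrow> frechet_derivative f (at x) v = f' v"
  using frechet_derivative_at[of f f' x] by simp

text \<open>
  The derivative at a point depends on the germ of the map there, and on an open set equality of values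
  gives equality of germs.
\<close>

lemma Ck_on_cong:
  assumes "open S"
  shows "Ck_on k f S \<Longrightarrow> (\<And>x. x \<in> S \<Longrightarrow> f x = g x) \<Longrightarrow> Ck_on k g S"
proof (induction k arbitrary: f g)
  case 0
  then show ?case by (auto cong: continuous_on_cong)
next
  case (Suc k)
  have D: "(g has_derivative frechet_derivative f (at x)) (at x)" if "x \<in> S" for x
  proof (rule has_derivative_transform_within_open[OF _ assms that])
    show "(f has_derivative frechet_derivative f (at x)) (at x)"
      using Suc.prems(1) that by (simp add: frechet_derivative_works)
  qed (use Suc.prems(2) in simp)
  have "Ck_on k (\<lambda>x. frechet_derivative g (at x) v) S" for v
  proof (rule Suc.IH)
    show "Ck_on k (\<lambda>x. frechet_derivative f (at x) v) S"
      using Suc.prems(1) by simp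
    show "frechet_derivative f (at x) v = frechet_derivative g (at x) v" if "x \<in> S" for x
      using frechet_derivative_at[OF D[OF that]] by simp
  qed
  moreover have "g differentiable (at x)" if "x \<in> S" for x
    using D[OF that] by (rule differentiableI)
  ultimately show ?case by simp
qed

text \<open>
  The introduction rule behind all closure properties below: any family of derivatives may be
  used in place of \<open>frechet_derivative\<close>.
\<close>

lemma Ck_on_SucI:
  assumes S: "open S" and D: "\<And>x. x \<in> S \<Longrightarrow> (f has_derivative f' x) (at x)"
    and C: "\<And>v. Ck_on k (\<lambda>x. f' x v) S"
  shows "Ck_on (Suc k) f S"
proof -
  have "frechet_derivative f (at x) = f' x" if "x \<in> S" for x
    using frechet_derivative_at[OF D[OF that]] by simp
  then have "Ck_on k (\<lambda>x. frechet_derivative f (at x) v) S" for v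
    using Ck_on_cong[OF S C[of v]] by simp
  moreover have "f differentiable (at x)" if "x \<in> S" for x
    using D[OF that] by (rule differentiableI)
  ultimately show ?thesis by simp
qed

lemma Ck_on_has_derivative:
  assumes "Ck_on (Suc k) f S" "x \<in> S"
  shows "(f has_derivative frechet_derivative f (at x)) (at x)"
  using assms by (simp add: frechet_derivative_works)

lemma Ck_on_SucD: "Ck_on (Suc k) f S \<Longrightarrow> Ck_on k f S"
proof (induction k arbitrary: f)
  case 0
  then show ?case
    by (auto intro!: continuous_at_imp_continuous_on differentiable_imp_continuous_within)
next
  case (Suc k)
  then have "\<forall>v. Ck_on k (\<lambda>x. frechet_derivative f (at x) v) S"
    by (metis Ck_on.simps(2))
  with Suc.prems show ?case
    unfolding Ck_on.simps(2)[of k] Ck_on.simps(2)[of "Suc k"] by blast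
qed

lemma Ck_on_subset: "Ck_on k f S \<Longrightarrow> T \<subseteq> S \<Longrightarrow> Ck_on k f T"
proof (induction k arbitrary: f)
  case 0
  then show ?case using continuous_on_subset by auto
next
  case (Suc k)
  then show ?case by (simp add: subset_iff)
qed

lemma Ck_on_const: "open S \<Longrightarrow> Ck_on k (\<lambda>x. c) S"
  by (induction k arbitrary: c) simp_all

lemma Ck_on_linear:
  assumes L: "bounded_linear L" and S: "open S"
  shows "Ck_on k f S \<Longrightarrow> Ck_on k (\<lambda>x. L (f x)) S"
proof (induction k arbitrary: f)
  case 0
  then show ?case
    using bounded_linear.continuous_on[OF L] by simp
next
  case (Suc k)
  show ?case
  proof (rule Ck_on_SucI[OF S])
    fix x assume "x \<in> S"
    then show "((\<lambda>x. L (f x)) has_derivative (\<lambda>v. L (frechet_derivative f (at x) v))) (at x)"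
      using bounded_linear.has_derivative[OF L] Ck_on_has_derivative[OF Suc.prems] by blast
  next
    fix v
    show "Ck_on k (\<lambda>x. L (frechet_derivative f (at x) v)) S"
      using Suc by simp
  qed
qed

lemma Ck_on_add:
  assumes S: "open S"
  shows "\<lbrakk>Ck_on k f S; Ck_on k g S\<rbrakk> \<Longrightarrow> Ck_on k (\<lambda>x. f x + g x) S"
proof (induction k arbitrary: f g)
  case 0
  then show ?case by (simp add: continuous_on_add)
next
  case (Suc k)
  show ?case
  proof (rule Ck_on_SucI[OF S])
    fix x assume x: "x \<in> S"
    show "((\<lambda>x. f x + g x) has_derivative
        (\<lambda>v. frechet_derivative f (at x) v + frechet_derivative g (at x) v)) (at x)"
      using Suc.prems[THEN Ck_on_has_derivative, OF x] by (rule has_derivative_add)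
  next
    fix v
    show "Ck_on k (\<lambda>x. frechet_derivative f (at x) v + frechet_derivative g (at x) v) S"
      using Suc by simp
  qed
qed

lemma Ck_on_bilinear:
  assumes h: "bounded_bilinear h" and S: "open S"
  shows "\<lbrakk>Ck_on k f S; Ck_on k g S\<rbrakk> \<Longrightarrow> Ck_on k (\<lambda>x. h (f x) (g x)) S"
proof (induction k arbitrary: f g)
  case 0
  then show ?case
    using bounded_bilinear.continuous_on[OF h] by simp
next
  case (Suc k)
  show ?case
  proof (rule Ck_on_SucI[OF S])
    fix x assume x: "x \<in> S"
    show "((\<lambda>x. h (f x) (g x)) has_derivative
        (\<lambda>v. h (f x) (frechet_derivative g (at x) v) + h (frechet_derivative f (at x) v) (g x))) (at x)"
      using Suc.prems[THEN Ck_on_has_derivative, OF x] by (rule bounded_bilinear.FDERIV[OF h])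
  next
    fix v
    show "Ck_on k (\<lambda>x. h (f x) (frechet_derivative g (at x) v)
        + h (frechet_derivative f (at x) v) (g x)) S"
      using Suc.prems by (intro Ck_on_add[OF S] Suc.IH) (auto dest: Ck_on_SucD simp del: Ck_on.simps(2), auto)
  qed
qed

lemma Ck_on_sum:
  assumes S: "open S"
  shows "(\<And>i. i \<in> I \<Longrightarrow> Ck_on k (f i) S) \<Longrightarrow> Ck_on k (\<lambda>x. \<Sum>i\<in>I. f i x) S"
  by (induction I rule: infinite_finite_induct)
    (simp_all add: Ck_on_const Ck_on_add S del: Ck_on.simps)

lemma sum_Axes_components: "(\<Sum>i\<in>Axes. (x \<bullet> i) *\<^sub>R i) = (x::'e::cartesian_space)"
proof -
  have "(\<Sum>i\<in>Axes. (x \<bullet> i) *\<^sub>R i) \<bullet> u = x \<bullet> u" if "u \<in> Axes" for u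
    using that by (simp add: finite_Axes inner_sum_left inner_Axes if_distrib cong: if_cong)
  then show ?thesis
    using Axes_all_zero_iff[of "(\<Sum>i\<in>Axes. (x \<bullet> i) *\<^sub>R i) - x"] by (simp add: inner_diff_left)
qed

lemma linear_sum_Axes:
  assumes "linear L"
  shows "L x = (\<Sum>i\<in>Axes. (x \<bullet> i) *\<^sub>R L (i::'e::cartesian_space))"
  using sum_Axes_components[of x] by (metis (no_types, lifting) assms linear_scale linear_sum sum.cong)

text \<open>
  The chain rule is not directly of the form to which the induction hypothesis applies, because
  \<open>Dg(f(x))\<close> is evaluated at a vector \<open>Df(x)v\<close> that varies with \<open>x\<close>. Expanding that vector in the standard
  basis leaves scalar functions times derivatives of \<open>g\<close> in fixed directions; this is where finite
  dimension enters.
\<close>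

lemma Ck_on_compose:
  fixes g :: "'e::cartesian_space \<Rightarrow> 'f::real_normed_vector"
  assumes S: "open S" and fS: "f ` S \<subseteq> T"
  shows "\<lbrakk>Ck_on k g T; Ck_on k f S\<rbrakk> \<Longrightarrow> Ck_on k (\<lambda>x. g (f x)) S"
proof (induction k arbitrary: g)
  case 0
  then show ?case
    using fS by (auto intro: continuous_on_compose2)
next
  case (Suc k)
  let ?D = frechet_derivative
  show ?case
  proof (rule Ck_on_SucI[OF S])
    fix x assume x: "x \<in> S"
    with fS have fx: "f x \<in> T" by auto
    have "((\<lambda>x. g (f x)) has_derivative (\<lambda>v. ?D g (at (f x)) (?D f (at x) v))) (at x)"
      by (rule has_derivative_compose[OF Ck_on_has_derivative[OF Suc.prems(2) x]
        Ck_on_has_derivative[OF Suc.prems(1) fx]])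
    moreover have "linear (?D g (at (f x)))"
      using Suc.prems(1) fx by (simp add: linear_frechet_derivative)
    ultimately show "((\<lambda>x. g (f x)) has_derivative
        (\<lambda>v. \<Sum>i\<in>Axes. (?D f (at x) v \<bullet> i) *\<^sub>R ?D g (at (f x)) i)) (at x)"
      by (simp flip: linear_sum_Axes)
  next
    fix v
    have "Ck_on k (\<lambda>x. ?D f (at x) v \<bullet> i) S" for i
      using Suc.prems(2) by (intro Ck_on_linear[OF bounded_linear_inner_left S]) simp
    moreover have "Ck_on k (\<lambda>x. ?D g (at (f x)) i) S" for i
      using Suc.prems Ck_on_SucD by (intro Suc.IH) auto
    ultimately show "Ck_on k (\<lambda>x. \<Sum>i\<in>Axes. (?D f (at x) v \<bullet> i) *\<^sub>R ?D g (at (f x)) i) S"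
      by (intro Ck_on_sum[OF S] Ck_on_bilinear[OF bounded_bilinear_scaleR S])
  qed
qed

lemma smooth_on_cong: "\<lbrakk>smooth_on f S; open S; \<And>x. x \<in> S \<Longrightarrow> f x = g x\<rbrakk> \<Longrightarrow> smooth_on g S"
  unfolding smooth_on_def using Ck_on_cong by blast

lemma smooth_on_subset: "\<lbrakk>smooth_on f S; T \<subseteq> S\<rbrakk> \<Longrightarrow> smooth_on f T"
  unfolding smooth_on_def using Ck_on_subset by blast

lemma smooth_on_linear:
  assumes "bounded_linear L" "open S" 
  shows "smooth_on L S"
proof -
  have "Ck_on k L S" for k
    using assms by (cases k)
      (auto intro!: Ck_on_SucI Ck_on_const bounded_linear_imp_has_derivative 
        linear_continuous_on simp del: Ck_on.simps(2))
  then show ?thesis by (simp add: smooth_on_def)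
qed

lemma smooth_on_linear_comp: "\<lbrakk>bounded_linear L; open S; smooth_on f S\<rbrakk> \<Longrightarrow> smooth_on (\<lambda>x. L (f x)) S"
  by (simp add: smooth_on_def Ck_on_linear)

lemma smooth_on_bilinear:
  "\<lbrakk>bounded_bilinear h; open S; smooth_on f S; smooth_on g S\<rbrakk> \<Longrightarrow> smooth_on (\<lambda>x. h (f x) (g x)) S"
  by (simp add: smooth_on_def Ck_on_bilinear)

lemma smooth_on_sum:
  "\<lbrakk>open S; \<And>i. i \<in> I \<Longrightarrow> smooth_on (f i) S\<rbrakk> \<Longrightarrow> smooth_on (\<lambda>x. \<Sum>i\<in>I. f i x) S"
  by (simp add: smooth_on_def Ck_on_sum)

lemma smooth_on_Pair:
  assumes "open S" "smooth_on f S" "smooth_on g S"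
  shows "smooth_on (\<lambda>x. (f x, g x)) S"
proof -
  have "bounded_linear (\<lambda>x. (x::'b, 0::'c))" "bounded_linear (\<lambda>y. (0::'b, y::'c))"
    by (intro bounded_linear_Pair bounded_linear_ident bounded_linear_zero)+
  then have "Ck_on k (\<lambda>x. (f x, 0) + (0, g x)) S" for k
    using assms Ck_on_linear[of "\<lambda>x. (x, 0)" S k f] Ck_on_linear[of "\<lambda>y. (0, y)" S k g]
    by (intro Ck_on_add) (auto simp: smooth_on_def)
  then show ?thesis by (simp add: smooth_on_def)
qed

lemma smooth_on_compose:
  fixes g :: "'e::cartesian_space \<Rightarrow> 'f::real_normed_vector"
  shows "\<lbrakk>smooth_on g T; smooth_on f S; open S; f ` S \<subseteq> T\<rbrakk> \<Longrightarrow> smooth_on (\<lambda>x. g (f x)) S"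
  unfolding smooth_on_def using Ck_on_compose by blast

lemma smooth_on_has_derivative:
  "\<lbrakk>smooth_on f S; x \<in> S\<rbrakk> \<Longrightarrow> (f has_derivative frechet_derivative f (at x)) (at x)"
  using Ck_on_has_derivative unfolding smooth_on_def by blast

lemma smooth_on_imp_continuous_on: "smooth_on f S \<Longrightarrow> continuous_on S f"
  unfolding smooth_on_def using Ck_on.simps(1) by blast

lemma smooth_on_frechet_derivative:
  "smooth_on f S \<Longrightarrow> smooth_on (\<lambda>x. frechet_derivative f (at x) v) S"
  unfolding smooth_on_def using Ck_on.simps(2) by blast

section \<open>Inversion of smooth families of matrices\<close>

text \<open>
  The resolvent identity \<open>B' - B = - B' (A' - A) B\<close>. It yields both the continuity and the derivative
  of the inverse, so that determinants and Cramer's rule can be avoided.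
\<close>

lemma inverse_matrices_diff:
  assumes "inverse_matrices A B" "inverse_matrices A' B'" "i \<in> Axes" "j \<in> Axes"
  shows "B' i j - B i j = - (\<Sum>k\<in>Axes. \<Sum>l\<in>Axes. B' i k * ((A' k l - A k l) * B l j))"
proof -
  have "(\<Sum>k\<in>Axes. \<Sum>l\<in>Axes. B' i k * (A' k l * B l j))
      = (\<Sum>l\<in>Axes. (\<Sum>k\<in>Axes. B' i k * A' k l) * B l j)"
    by (subst sum.swap) (simp add: sum_distrib_right mult.assoc)
  also have "\<dots> = (\<Sum>l\<in>Axes. (if i = l then 1 else 0) * B l j)"
    using assms by (intro sum.cong) (auto simp: inverse_matrices_def)
  also have "\<dots> = B i j"
    using assms by (simp add: finite_Axes if_distrib[where f = "\<lambda>c. c * _"] cong: if_cong)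
  finally have 1: "(\<Sum>k\<in>Axes. \<Sum>l\<in>Axes. B' i k * (A' k l * B l j)) = B i j" .
  have "(\<Sum>k\<in>Axes. \<Sum>l\<in>Axes. B' i k * (A k l * B l j)) = (\<Sum>k\<in>Axes. B' i k * (\<Sum>l\<in>Axes. A k l * B l j))"
    by (simp add: sum_distrib_left)
  also have "\<dots> = (\<Sum>k\<in>Axes. B' i k * (if k = j then 1 else 0))"
    using assms by (intro sum.cong) (auto simp: inverse_matrices_def)
  also have "\<dots> = B' i j"
    using assms by (simp add: finite_Axes if_distrib cong: if_cong)
  finally have 2: "(\<Sum>k\<in>Axes. \<Sum>l\<in>Axes. B' i k * (A k l * B l j)) = B' i j" .
  show ?thesis
    unfolding left_diff_distrib right_diff_distrib sum_subtractf 1 2 by simp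
qed

text \<open>
  Only \<open>A\<close> is known to be continuous, so the resolvent identity first has to bound \<open>B\<close> near \<open>a\<close>. With
  \<open>\<beta>\<close> the sum of the absolute values of the entries of \<open>B\<close>, \<open>\<epsilon>\<close> that of the entries of \<open>A - A(a)\<close> and \<open>n\<close>
  the dimension, it gives \<open>\<beta> \<le> \<beta>(a) + n\<^sup>2 \<beta>(a) \<epsilon> \<beta>\<close>, hence \<open>\<beta> \<le> 2 \<beta>(a)\<close> once \<open>n\<^sup>2 \<beta>(a) \<epsilon> < 1/2\<close>. Inserting
  this bound into the identity again gives convergence.
\<close>

lemma isCont_matrix_inverse:
  fixes A B :: "'x::real_normed_vector \<Rightarrow> 'i::cartesian_space \<Rightarrow> 'i \<Rightarrow> real"
  assumes A: "\<And>i j. i \<in> Axes \<Longrightarrow> j \<in> Axes \<Longrightarrow> isCont (\<lambda>x. A x i j) a"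
    and inv: "\<forall>\<^sub>F x in nhds a. inverse_matrices (A x) (B x)"
    and ij: "i \<in> Axes" "j \<in> Axes"
  shows "isCont (\<lambda>x. B x i j) a"
proof -
  define \<beta> where "\<beta> x = (\<Sum>i\<in>Axes. \<Sum>j\<in>Axes. \<bar>B x i j\<bar>)" for x
  define \<epsilon> where "\<epsilon> x = (\<Sum>i\<in>Axes. \<Sum>j\<in>Axes. \<bar>A x i j - A a i j\<bar>)" for x
  define n where "n = real (card (Axes::'i set))"
  have \<beta>0: "0 \<le> \<beta> x" for x unfolding \<beta>_def by (intro sum_nonneg) auto
  have entry: "\<bar>B x i j\<bar> \<le> \<beta> x" if "i \<in> Axes" "j \<in> Axes" for x i j
  proof -
    have "\<bar>B x i j\<bar> \<le> (\<Sum>j\<in>Axes. \<bar>B x i j\<bar>)"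
      using that by (intro member_le_sum) (auto simp: finite_Axes)
    also have "\<dots> \<le> \<beta> x"
      unfolding \<beta>_def using that by (intro member_le_sum) (auto simp: finite_Axes intro: sum_nonneg)
    finally show ?thesis .
  qed
  have inva: "inverse_matrices (A a) (B a)" using inv by (rule eventually_nhds_x_imp_x)
  have dB: "\<bar>B x i j - B a i j\<bar> \<le> \<beta> x * \<epsilon> x * \<beta> a"
    if "inverse_matrices (A x) (B x)" "i \<in> Axes" "j \<in> Axes" for x i j
  proof -
    have "\<bar>B x i j - B a i j\<bar> = \<bar>\<Sum>k\<in>Axes. \<Sum>l\<in>Axes. B x i k * ((A x k l - A a k l) * B a l j)\<bar>"
      using inverse_matrices_diff[OF inva that] by simp
    also have "\<dots> \<le> (\<Sum>k\<in>Axes. \<Sum>l\<in>Axes. \<bar>B x i k * ((A x k l - A a k l) * B a l j)\<bar>)"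
      by (intro order.trans[OF sum_abs] sum_mono sum_abs)
    also have "\<dots> \<le> (\<Sum>k\<in>Axes. \<Sum>l\<in>Axes. \<beta> x * (\<bar>A x k l - A a k l\<bar> * \<beta> a))"
      unfolding abs_mult using that by (intro sum_mono mult_mono entry) (auto simp: \<beta>0)
    also have "\<dots> = \<beta> x * \<epsilon> x * \<beta> a"
      by (simp add: \<epsilon>_def sum_distrib_left sum_distrib_right mult.assoc)
    finally show ?thesis .
  qed
  have \<epsilon>: "(\<epsilon> \<longlongrightarrow> 0) (at a)"
  proof -
    have "(\<epsilon> \<longlongrightarrow> (\<Sum>i\<in>(Axes::'i set). \<Sum>j\<in>(Axes::'i set). \<bar>A a i j - A a i j\<bar>)) (at a)"
      unfolding \<epsilon>_def using A by (intro tendsto_intros) (auto simp: isCont_def)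
    then show ?thesis by simp
  qed
  have "((\<lambda>x. n * n * \<beta> a * \<epsilon> x) \<longlongrightarrow> n * n * \<beta> a * 0) (at a)"
    by (intro tendsto_intros \<epsilon>)
  then have small: "\<forall>\<^sub>F x in at a. n * n * \<beta> a * \<epsilon> x < 1/2"
    by (rule order_tendstoD) simp
  have inv': "\<forall>\<^sub>F x in at a. inverse_matrices (A x) (B x)"
    using inv eventually_nhds_conv_at by blast
  have b: "\<forall>\<^sub>F x in at a. norm (B x i j - B a i j) \<le> 2 * \<beta> a * \<epsilon> x * \<beta> a"
    using small inv'
  proof eventually_elim
    case (elim x)
    have "\<beta> x = (\<Sum>i\<in>Axes. \<Sum>j\<in>Axes. \<bar>B x i j\<bar>)"
      by (rule \<beta>_def)
    also have "\<dots> \<le> (\<Sum>i\<in>(Axes::'i set). \<Sum>j\<in>(Axes::'i set). \<bar>B a i j\<bar> + \<beta> x * \<epsilon> x * \<beta> a)"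
    proof (intro sum_mono)
      fix i j assume "i \<in> (Axes::'i set)" "j \<in> (Axes::'i set)"
      from dB[OF elim(2) this] show "\<bar>B x i j\<bar> \<le> \<bar>B a i j\<bar> + \<beta> x * \<epsilon> x * \<beta> a" by linarith
    qed
    also have "\<dots> = \<beta> a + (n * n * \<beta> a * \<epsilon> x) * \<beta> x"
      by (simp add: \<beta>_def[of a] n_def sum.distrib algebra_simps)
    also have "\<dots> \<le> \<beta> a + 1/2 * \<beta> x"
      using elim(1) \<beta>0 by (intro add_left_mono mult_right_mono) auto
    finally have "\<beta> x \<le> 2 * \<beta> a" by simp
    moreover have "0 \<le> \<epsilon> x" unfolding \<epsilon>_def by (intro sum_nonneg) auto
    ultimately have "\<beta> x * \<epsilon> x * \<beta> a \<le> 2 * \<beta> a * \<epsilon> x * \<beta> a"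
      using \<beta>0 by (intro mult_right_mono) auto
    with dB[OF elim(2) ij] show ?case by simp
  qed
  have "((\<lambda>x. 2 * \<beta> a * \<epsilon> x * \<beta> a) \<longlongrightarrow> 2 * \<beta> a * 0 * \<beta> a) (at a)"
    by (intro tendsto_intros \<epsilon>)
  then have "((\<lambda>x. 2 * \<beta> a * \<epsilon> x * \<beta> a) \<longlongrightarrow> 0) (at a)"
    by simp
  with b have "((\<lambda>x. B x i j - B a i j) \<longlongrightarrow> 0) (at a)"
    by (rule Lim_null_comparison)
  then show ?thesis
    unfolding isCont_def by (rule LIM_zero_cancel)
qed

text \<open>
  A product rule in which one factor is merely continuous, at the price that the other one vanishes. It
  differentiates the resolvent identity, whose factor \<open>B'\<close> is not yet known to be differentiable.
\<close>

lemma has_derivative_mult_vanishing: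
  fixes g h :: "'x::real_normed_vector \<Rightarrow> real"
  assumes g: "(g has_derivative g') (at a)" and ga: "g a = 0" and h: "isCont h a"
  shows "((\<lambda>x. h x * g x) has_derivative (\<lambda>v. h a * g' v)) (at a)"
  unfolding has_derivative_iff_norm
proof
  have bl: "bounded_linear g'" using g by (rule has_derivative_bounded_linear)
  then show "bounded_linear (\<lambda>v. h a * g' v)" by (intro bounded_linear_const_mult)
  obtain K where K: "\<And>v. norm (g' v) \<le> norm v * K" "0 < K"
    using bounded_linear.pos_bounded[OF bl] by metis
  have o: "((\<lambda>y. norm (g y - g a - g' (y - a)) / norm (y - a)) \<longlongrightarrow> 0) (at a)"
    using g by (simp add: has_derivative_iff_norm)
  have h': "(h \<longlongrightarrow> h a) (at a)" using h by (simp add: isCont_def)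
  let ?b = "\<lambda>y. \<bar>h y\<bar> * (norm (g y - g a - g' (y - a)) / norm (y - a)) + \<bar>h y - h a\<bar> * K"
  have "(?b \<longlongrightarrow> \<bar>h a\<bar> * 0 + \<bar>h a - h a\<bar> * K) (at a)"
    by (rule tendsto_add[OF tendsto_mult[OF tendsto_rabs[OF h'] o]
          tendsto_mult[OF tendsto_rabs[OF tendsto_diff[OF h' tendsto_const]] tendsto_const]])
  then have b0: "(?b \<longlongrightarrow> 0) (at a)" by simp
  have b: "norm (norm (h y * g y - h a * g a - h a * g' (y - a)) / norm (y - a)) \<le> ?b y"
    if "y \<noteq> a" for y
  proof -
    have "h y * g y - h a * g a - h a * g' (y - a)
        = h y * (g y - g a - g' (y - a)) + (h y - h a) * g' (y - a)"
      by (simp add: ga algebra_simps)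
    then have "\<bar>h y * g y - h a * g a - h a * g' (y - a)\<bar>
        \<le> \<bar>h y\<bar> * \<bar>g y - g a - g' (y - a)\<bar> + \<bar>h y - h a\<bar> * \<bar>g' (y - a)\<bar>"
      by (simp only: abs_triangle_ineq flip: abs_mult)
    also have "\<dots> \<le> \<bar>h y\<bar> * \<bar>g y - g a - g' (y - a)\<bar> + \<bar>h y - h a\<bar> * (norm (y - a) * K)"
      using K(1)[of "y - a"] by (intro add_left_mono mult_left_mono) auto
    finally have "\<bar>h y * g y - h a * g a - h a * g' (y - a)\<bar> / norm (y - a)
        \<le> (\<bar>h y\<bar> * \<bar>g y - g a - g' (y - a)\<bar> + \<bar>h y - h a\<bar> * (norm (y - a) * K)) / norm (y - a)"
      by (rule divide_right_mono) simp
    then show ?thesis using that by (simp add: add_divide_distrib)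
  qed
  show "((\<lambda>y. norm (h y * g y - h a * g a - h a * g' (y - a)) / norm (y - a)) \<longlongrightarrow> 0) (at a)"
  proof (rule Lim_null_comparison[OF _ b0])
    show "\<forall>\<^sub>F y in at a. norm (norm (h y * g y - h a * g a - h a * g' (y - a)) / norm (y - a)) \<le> ?b y"
      using b by (intro eventually_at_filter[THEN iffD2] always_eventually allI impI)
  qed
qed

text \<open>
  The resolvent identity gives \<open>DB = - B (DA) B\<close>. So if \<open>B\<close> is \<open>C\<^sup>k\<close> then its derivative is \<open>C\<^sup>k\<close>, and \<open>B\<close> is
  \<open>C\<^sup>k\<^sup>+\<^sup>1\<close>; the induction starts with continuity.
\<close>

lemma smooth_on_matrix_inverse:
  fixes A B :: "'x::real_normed_vector \<Rightarrow> 'i::cartesian_space \<Rightarrow> 'i \<Rightarrow> real"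
  assumes S: "open S"
    and A: "\<And>i j. i \<in> Axes \<Longrightarrow> j \<in> Axes \<Longrightarrow> smooth_on (\<lambda>x. A x i j) S"
    and inv: "\<And>x. x \<in> S \<Longrightarrow> inverse_matrices (A x) (B x)"
    and ij: "i \<in> Axes" "j \<in> Axes"
  shows "smooth_on (\<lambda>x. B x i j) S"
proof -
  let ?D = "\<lambda>k l x. frechet_derivative (\<lambda>x. A x k l) (at x)"
  have inv': "\<forall>\<^sub>F x in nhds a. inverse_matrices (A x) (B x)" if "a \<in> S" for a
    using inv S that by (auto simp: eventually_nhds)
  have cont: "isCont (\<lambda>x. B x i j) a" if "a \<in> S" "i \<in> Axes" "j \<in> Axes" for a i j
  proof (rule isCont_matrix_inverse[OF _ inv'[OF that(1)] that(2,3)])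
    show "isCont (\<lambda>x. A x p q) a" if "p \<in> Axes" "q \<in> Axes" for p q
      using smooth_on_imp_continuous_on[OF A[OF that]] S \<open>a \<in> S\<close>
      by (simp add: continuous_on_eq_continuous_at)
  qed
  have deriv: "((\<lambda>x. B x i j) has_derivative
      (\<lambda>v. - (\<Sum>k\<in>Axes. \<Sum>l\<in>Axes. B a i k * (?D k l a v * B a l j)))) (at a)"
    if a: "a \<in> S" and ij: "i \<in> Axes" "j \<in> Axes" for a i j
  proof -
    have "((\<lambda>x. B x i k * ((A x k l - A a k l) * B a l j)) has_derivative
        (\<lambda>v. B a i k * (?D k l a v * B a l j))) (at a)" if "k \<in> Axes" "l \<in> Axes" for k l
    proof (rule has_derivative_mult_vanishing)
      have "((\<lambda>x. A x k l) has_derivative ?D k l a) (at a)"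
        using A[OF that] a by (rule smooth_on_has_derivative)
      then show "((\<lambda>x. (A x k l - A a k l) * B a l j) has_derivative (\<lambda>v. ?D k l a v * B a l j)) (at a)"
        by (auto intro!: derivative_eq_intros)
    qed (use a ij that cont in auto)
    then have "((\<lambda>x. B a i j - (\<Sum>k\<in>Axes. \<Sum>l\<in>Axes. B x i k * ((A x k l - A a k l) * B a l j)))
      has_derivative (\<lambda>v. 0 - (\<Sum>k\<in>Axes. \<Sum>l\<in>Axes. B a i k * (?D k l a v * B a l j)))) (at a)"
      by (intro has_derivative_diff has_derivative_const has_derivative_sum)
    then have "((\<lambda>x. B x i j) has_derivative
        (\<lambda>v. 0 - (\<Sum>k\<in>Axes. \<Sum>l\<in>Axes. B a i k * (?D k l a v * B a l j)))) (at a)"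
    proof (rule has_derivative_transform_within_open[OF _ S a])
      fix x assume "x \<in> S"
      then show "B a i j - (\<Sum>k\<in>Axes. \<Sum>l\<in>Axes. B x i k * ((A x k l - A a k l) * B a l j)) = B x i j"
        using inverse_matrices_diff[OF inv[OF a] inv[OF \<open>x \<in> S\<close>] ij] by simp
    qed
    then show ?thesis by simp
  qed
  have "\<forall>i\<in>Axes. \<forall>j\<in>Axes. Ck_on k (\<lambda>x. B x i j) S" for k
  proof (induction k)
    case 0
    then show ?case using cont S by (auto simp: continuous_on_eq_continuous_at)
  next
    case (Suc k)
    show ?case
    proof (intro ballI)
      fix i j assume ij: "i \<in> (Axes::'i set)" "j \<in> (Axes::'i set)"
      show "Ck_on (Suc k) (\<lambda>x. B x i j) S"
      proof (rule Ck_on_SucI[OF S deriv])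
        fix v
        have "Ck_on k (\<lambda>x. ?D p q x v) S" if "p \<in> Axes" "q \<in> Axes" for p q
          using smooth_on_frechet_derivative[OF A[OF that]] by (simp add: smooth_on_def)
        then show "Ck_on k (\<lambda>x. - (\<Sum>k\<in>Axes. \<Sum>l\<in>Axes. B x i k * (?D k l x v * B x l j))) S"
          using Suc.IH ij
          by (intro Ck_on_linear[OF bounded_linear_minus[OF bounded_linear_ident] S] Ck_on_sum[OF S]
              Ck_on_bilinear[OF bounded_bilinear_mult S]) auto
      qed (use ij in auto)
    qed
  qed
  then show ?thesis using ij by (simp add: smooth_on_def)
qed

section \<open>Charts and the chain rule on manifolds\<close>

lemma charts_at_iff: "c \<in> charts_at M m \<longleftrightarrow> c \<in> atlas M \<and> m \<in> fst c"
  by (simp add: charts_at_def)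

lemma chart_openin: "smooth_manifold M \<Longrightarrow> c \<in> atlas M \<Longrightarrow> openin (mtop M) (fst c)"
  by (simp add: smooth_manifold_def)

lemma charts_at_imp_point: "smooth_manifold M \<Longrightarrow> c \<in> charts_at M m \<Longrightarrow> m \<in> points M"
  by (auto simp: smooth_manifold_def charts_at_iff)

lemma some_chart_in: "smooth_manifold M \<Longrightarrow> m \<in> points M \<Longrightarrow> some_chart M m \<in> charts_at M m"
  unfolding some_chart_def
proof (rule someI_ex)
  assume "smooth_manifold M" "m \<in> points M"
  then have "m \<in> (\<Union>c\<in>atlas M. fst c)" by (simp only: smooth_manifold_def)
  then show "\<exists>c. c \<in> charts_at M m" by (auto simp: charts_at_iff)
qed

lemma chart_homeomorphic:
  "smooth_manifold M \<Longrightarrow> c \<in> atlas M \<Longrightarrow>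
    homeomorphic_map (subtopology (mtop M) (fst c)) (top_of_set (snd c ` fst c)) (snd c)"
  by (simp add: smooth_manifold_def)

lemma chart_inj_on:
  assumes "smooth_manifold M" "c \<in> atlas M"
  shows "inj_on (snd c) (fst c)"
  using homeomorphic_imp_injective_map[OF chart_homeomorphic[OF assms]]
    openin_subset[OF chart_openin[OF assms]]
  by (simp add: Int_absorb1)

lemma chart_inv_chart: "smooth_manifold M \<Longrightarrow> c \<in> charts_at M m \<Longrightarrow> chart_inv c (snd c m) = m"
  by (simp add: chart_inv_def chart_inj_on charts_at_iff)

lemma chart_rep_chart:
  "smooth_manifold M \<Longrightarrow> c \<in> charts_at M m \<Longrightarrow> chart_rep c f d (snd c m) = snd d (f m)"
  by (simp add: chart_rep_def chart_inv_chart)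

lemma open_chart_image:
  assumes "smooth_manifold M" "c \<in> atlas M" "openin (mtop M) U" "U \<subseteq> fst c"
  shows "open (snd c ` U)"
proof -
  have "openin (subtopology (mtop M) (fst c)) U"
    using assms(3,4) by (meson openin_subtopology_Int2 subset_openin_subtopology)
  then have "openin (top_of_set (snd c ` fst c)) (snd c ` U)"
    using homeomorphic_imp_open_map[OF chart_homeomorphic[OF assms(1,2)]] by (simp add: open_map_def)
  moreover have "open (snd c ` fst c)"
    using assms(1,2) by (simp add: smooth_manifold_def)
  ultimately show ?thesis
    using openin_open_trans by blast
qed

lemma openin_chart_preimage:
  assumes "smooth_manifold M" "c \<in> atlas M" "continuous_map (mtop M) (mtop N) f" "openin (mtop N) V"
  shows "openin (mtop M) (fst c \<inter> f -` V)"
proof -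
  have "fst c \<inter> f -` V = fst c \<inter> {x \<in> points M. f x \<in> V}"
    using openin_subset[OF chart_openin[OF assms(1,2)]] by auto
  then show ?thesis
    using openin_continuous_map_preimage[OF assms(3,4)] chart_openin[OF assms(1,2)] by auto
qed

lemma open_chart_preimage:
  assumes "smooth_manifold M" "c \<in> atlas M" "continuous_map (mtop M) (mtop N) f" "openin (mtop N) V"
  shows "open (snd c ` (fst c \<inter> f -` V))"
  using openin_chart_preimage[OF assms] by (intro open_chart_image[OF assms(1,2)]) auto

lemma smooth_map_id: "smooth_manifold M \<Longrightarrow> smooth_map M M (\<lambda>m. m)"
  by (simp add: smooth_manifold_def smooth_map_def vimage_def Collect_mem_eq)

lemma smooth_map_in: "smooth_map M N f \<Longrightarrow> m \<in> points M \<Longrightarrow> f m \<in> points N"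
  unfolding smooth_map_def continuous_map_def by auto

lemma chart_rep_has_derivative:
  assumes "smooth_map M N f" "c \<in> charts_at M m" "d \<in> charts_at N (f m)"
  shows "(chart_rep c f d has_derivative frechet_derivative (chart_rep c f d) (at (snd c m))) (at (snd c m))"
proof (rule smooth_on_has_derivative)
  show "smooth_on (chart_rep c f d) (snd c ` (fst c \<inter> f -` fst d))"
    using assms by (simp add: smooth_map_def charts_at_iff)
  show "snd c m \<in> snd c ` (fst c \<inter> f -` fst d)"
    using assms by (simp add: charts_at_iff)
qed

lemma linear_chart_rep_derivative:
  assumes "smooth_map M N f" "c \<in> charts_at M m" "d \<in> charts_at N (f m)"
  shows "linear (frechet_derivative (chart_rep c f d) (at (snd c m)))"
  using has_derivative_linear[OF chart_rep_has_derivative[OF assms]] .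

text \<open>
  The source of all independence of charts: with \<open>f\<close> or \<open>g\<close> the identity, this is the
  transformation law of coordinate representations under a change of chart. The two coordinate
  representations agree only near the point, where \<open>f\<close> stays in the domain of \<open>d\<close>.
\<close>

lemma chart_rep_chain:
  assumes M: "smooth_manifold M" and N: "smooth_manifold N"
    and f: "smooth_map M N f" and g: "smooth_map N P g"
    and c: "c \<in> charts_at M m" and d: "d \<in> charts_at N (f m)" and e: "e \<in> charts_at P (g (f m))"
  shows "frechet_derivative (chart_rep c (\<lambda>m. g (f m)) e) (at (snd c m)) x
    = frechet_derivative (chart_rep d g e) (at (snd d (f m)))
        (frechet_derivative (chart_rep c f d) (at (snd c m)) x)"
proof -
  let ?f' = "frechet_derivative (chart_rep c f d) (at (snd c m))"
  let ?g' = "frechet_derivative (chart_rep d g e) (at (snd d (f m)))"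
  let ?S = "snd c ` (fst c \<inter> f -` fst d)"
  have "((\<lambda>x. chart_rep d g e (chart_rep c f d x)) has_derivative (\<lambda>x. ?g' (?f' x))) (at (snd c m))"
    using chart_rep_has_derivative[OF g d e]
    by (intro has_derivative_compose[OF chart_rep_has_derivative[OF f c d]])
      (simp only: chart_rep_chart[OF M c])
  then have "(chart_rep c (\<lambda>m. g (f m)) e has_derivative (\<lambda>x. ?g' (?f' x))) (at (snd c m))"
  proof (rule has_derivative_transform_within_open)
    show "open ?S"
      using f c d by (intro open_chart_preimage[OF M, of _ N] chart_openin[OF N])
        (auto simp: smooth_map_def charts_at_iff)
    show "snd c m \<in> ?S"
      using c d by (auto simp: charts_at_iff)
    fix y assume "y \<in> ?S"
    then obtain m' where "y = snd c m'" "c \<in> charts_at M m'" "d \<in> charts_at N (f m')"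
      using c d by (auto simp: charts_at_iff)
    then show "chart_rep d g e (chart_rep c f d y) = chart_rep c (\<lambda>m. g (f m)) e y"
      using M N by (simp add: chart_rep_chart)
  qed
  then show ?thesis
    by (rule frechet_derivative_eqI)
qed

section \<open>Tangent vectors and differentials\<close>

lemma transition_self_derivative:
  assumes M: "smooth_manifold M" and c: "c \<in> charts_at M m"
  shows "frechet_derivative (transition c c) (at (snd c m)) x = x"
proof -
  have "(transition c c has_derivative (\<lambda>x. x)) (at (snd c m))"
  proof (rule has_derivative_transform_within_open[OF has_derivative_ident])
    show "open (snd c ` fst c)"
      using c M by (simp add: smooth_manifold_def charts_at_iff)
    show "snd c m \<in> snd c ` fst c"
      using c by (simp add: charts_at_iff)
    show "x = transition c c x" if "x \<in> snd c ` fst c" for x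
      using that M c by (auto simp: chart_rep_chart charts_at_iff)
  qed
  then show ?thesis
    by (rule frechet_derivative_eqI)
qed

lemma tangent_spaceI:
  assumes "\<And>c c'. c \<in> charts_at M m \<Longrightarrow> c' \<in> charts_at M m \<Longrightarrow>
      v c' = frechet_derivative (transition c c') (at (snd c m)) (v c)"
    and "\<And>c. c \<notin> charts_at M m \<Longrightarrow> v c = 0"
  shows "v \<in> tangent_space M m"
  unfolding tangent_space_def mem_Collect_eq using assms by blast

text \<open>
  Oriented so that rewriting with it terminates.
\<close>

lemma tangent_space_transition:
  "\<lbrakk>v \<in> tangent_space M m; c \<in> charts_at M m; c' \<in> charts_at M m\<rbrakk> \<Longrightarrow>
    frechet_derivative (transition c c') (at (snd c m)) (v c) = v c'"
  unfolding tangent_space_def mem_Collect_eq by metis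

lemma tangent_space_outside:
  "\<lbrakk>v \<in> tangent_space M m; c \<notin> charts_at M m\<rbrakk> \<Longrightarrow> v c = 0"
  unfolding tangent_space_def mem_Collect_eq by blast

lemma tvec_of_self: "smooth_manifold M \<Longrightarrow> c \<in> charts_at M m \<Longrightarrow> tvec_of M c m x c = x"
  by (simp add: tvec_of_def transition_self_derivative)

lemma tvec_of_in_tangent_space:
  assumes "smooth_manifold M" "c \<in> charts_at M m"
  shows "tvec_of M c m x \<in> tangent_space M m"
proof (rule tangent_spaceI)
  fix c' c'' assume c': "c' \<in> charts_at M m" "c'' \<in> charts_at M m"
  note id = smooth_map_id[OF assms(1)]
  show "tvec_of M c m x c'' = frechet_derivative (transition c' c'') (at (snd c' m)) (tvec_of M c m x c')"
    unfolding tvec_of_def if_P[OF c'(1)] if_P[OF c'(2)]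
    by (rule chart_rep_chain[OF assms(1,1) id id assms(2) c'])
qed (simp add: tvec_of_def)

lemma tvec_of_coords:
  assumes "v \<in> tangent_space M m" "c \<in> charts_at M m"
  shows "tvec_of M c m (v c) = v"
  using assms by (simp add: tvec_of_def fun_eq_iff tangent_space_transition tangent_space_outside)

text \<open>
  A tangent vector is determined by its coordinates in a single chart.
\<close>

lemma tangent_eqI:
  assumes "u \<in> tangent_space M m" "v \<in> tangent_space M m" "c \<in> charts_at M m" "u c = v c"
  shows "u = v"
  by (rule box_equals[OF arg_cong[OF assms(4)] tvec_of_coords[OF assms(1,3)] tvec_of_coords[OF assms(2,3)]])

lemma tvec_of_lincomb:
  assumes M: "smooth_manifold M" "c \<in> charts_at M m"
  shows "tvec_of M c m (a *\<^sub>R x + y) = (\<lambda>c'. a *\<^sub>R tvec_of M c m x c' + tvec_of M c m y c')"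
proof
  fix c'
  show "tvec_of M c m (a *\<^sub>R x + y) c' = a *\<^sub>R tvec_of M c m x c' + tvec_of M c m y c'"
  proof (cases "c' \<in> charts_at M m")
    case True
    note lin = linear_chart_rep_derivative[OF smooth_map_id[OF M(1)] M(2) True]
    from True show ?thesis
      by (simp add: tvec_of_def linear_add[OF lin] linear_scale[OF lin])
  qed (simp add: tvec_of_def)
qed

lemma tangent_space_lincomb:
  assumes M: "smooth_manifold M" "m \<in> points M"
    and uv: "u \<in> tangent_space M m" "v \<in> tangent_space M m"
  shows "(\<lambda>c. a *\<^sub>R u c + v c) \<in> tangent_space M m"
proof -
  have c: "some_chart M m \<in> charts_at M m" (is "?c \<in> _")
    using M by (rule some_chart_in)
  have "(\<lambda>c. a *\<^sub>R u c + v c) = tvec_of M ?c m (a *\<^sub>R u ?c + v ?c)"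
    using tvec_of_lincomb[OF M(1) c] tvec_of_coords[OF _ c] uv by simp
  then show ?thesis
    using tvec_of_in_tangent_space[OF M(1) c] by simp
qed

text \<open>
  The differential may be computed in any chart, not just in the one singled out by its definition.
\<close>

lemma differential_coords:
  assumes M: "smooth_manifold M" and N: "smooth_manifold N" and f: "smooth_map M N f"
    and c: "c \<in> charts_at M m" and d: "d \<in> charts_at N (f m)" and v: "v \<in> tangent_space M m"
  shows "differential M N f m v d = frechet_derivative (chart_rep c f d) (at (snd c m)) (v c)"
proof -
  have s: "some_chart M m \<in> charts_at M m" (is "?s \<in> _")
    using M charts_at_imp_point[OF M c] by (rule some_chart_in)
  show ?thesis
    unfolding differential_def Let_def if_P[OF d] chart_rep_chain[OF M M smooth_map_id[OF M] f s c d]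
    by (simp add: tangent_space_transition[OF v s c])
qed

lemma differential_in_tangent_space:
  assumes M: "smooth_manifold M" and N: "smooth_manifold N" and f: "smooth_map M N f"
    and m: "m \<in> points M" and v: "v \<in> tangent_space M m"
  shows "differential M N f m v \<in> tangent_space N (f m)"
proof -
  have c: "some_chart M m \<in> charts_at M m" (is "?c \<in> _")
    using M m by (rule some_chart_in)
  show ?thesis
  proof (rule tangent_spaceI)
    fix d d' assume d: "d \<in> charts_at N (f m)" "d' \<in> charts_at N (f m)"
    show "differential M N f m v d'
        = frechet_derivative (transition d d') (at (snd d (f m))) (differential M N f m v d)"
      unfolding differential_coords[OF M N f c d(1) v] differential_coords[OF M N f c d(2) v]
      by (rule chart_rep_chain[OF M N f smooth_map_id[OF N] c d])
  qed (simp add: differential_def Let_def)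
qed

lemma differential_lincomb:
  assumes M: "smooth_manifold M" and N: "smooth_manifold N" and f: "smooth_map M N f"
    and m: "m \<in> points M"
  shows "differential M N f m (\<lambda>c. a *\<^sub>R u c + v c)
    = (\<lambda>d. a *\<^sub>R differential M N f m u d + differential M N f m v d)"
proof
  fix d
  show "differential M N f m (\<lambda>c. a *\<^sub>R u c + v c) d
    = a *\<^sub>R differential M N f m u d + differential M N f m v d"
  proof (cases "d \<in> charts_at N (f m)")
    case True
    note lin = linear_chart_rep_derivative[OF f some_chart_in[OF M m] True]
    from True show ?thesis
      by (simp add: differential_def Let_def linear_add[OF lin] linear_scale[OF lin])
  qed (simp add: differential_def Let_def)
qed

section \<open>Bilinear forms and musical isomorphisms\<close>

text \<open>
  Linearity is required on the tangent space only, because off it covectors have arbitrary values.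
\<close>

definition linear_form :: "('a, 'e::cartesian_space) manifold \<Rightarrow> 'a \<Rightarrow> ('a, 'e) covec \<Rightarrow> bool" where
  "linear_form M m l \<longleftrightarrow> (\<forall>u\<in>tangent_space M m. \<forall>v\<in>tangent_space M m. \<forall>a.
     l (\<lambda>c. a *\<^sub>R u c + v c) = a * l u + l v)"

definition bilinear_field :: "('a, 'e::cartesian_space) manifold \<Rightarrow> ('a, 'e) tensor02 \<Rightarrow> bool" where
  "bilinear_field M \<tau> \<longleftrightarrow> (\<forall>m\<in>points M. \<forall>w\<in>tangent_space M m.
     linear_form M m (\<lambda>u. \<tau> m u w) \<and> linear_form M m (\<lambda>u. \<tau> m w u))"

lemma smooth_tensor_field_bilinear: "smooth_tensor_field M \<tau> \<Longrightarrow> bilinear_field M \<tau>"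
  by (simp add: smooth_tensor_field_def bilinear_field_def linear_form_def)

text \<open>
  Transported to the model space along \<open>tvec_of M c m\<close>, the form is an honest linear map and expands in
  the standard basis.
\<close>

lemma linear_form_coords:
  assumes M: "smooth_manifold M" and l: "linear_form M m l"
    and u: "u \<in> tangent_space M m" and c: "c \<in> charts_at M m"
  shows "l u = (\<Sum>i\<in>Axes. (u c \<bullet> i) * l (tvec_of M c m i))"
proof -
  let ?L = "\<lambda>x. l (tvec_of M c m x)"
  have lin: "?L (a *\<^sub>R x + y) = a * ?L x + ?L y" for a x y
    using l tvec_of_in_tangent_space[OF M c] by (simp add: linear_form_def tvec_of_lincomb[OF M c])
  have "linear ?L"
  proof
    show add: "?L (x + y) = ?L x + ?L y" for x y using lin[of 1 x y] by simp
    show "?L (a *\<^sub>R x) = a *\<^sub>R ?L x" for a x using lin[of a x 0] add[of 0 0] by simp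
  qed
  from linear_sum_Axes[OF this, of "u c"] show ?thesis
    by (simp add: tvec_of_coords[OF u c])
qed

lemma tensor_coords:
  assumes M: "smooth_manifold M" and \<tau>: "bilinear_field M \<tau>" and c: "c \<in> charts_at M m"
    and u: "u \<in> tangent_space M m" and v: "v \<in> tangent_space M m"
  shows "\<tau> m u v = (\<Sum>i\<in>Axes. \<Sum>j\<in>Axes. (u c \<bullet> i) * ((v c \<bullet> j) * tensor_coord M \<tau> c m i j))"
proof -
  have m: "m \<in> points M" using charts_at_imp_point[OF M c] .
  have "\<tau> m u v = (\<Sum>i\<in>Axes. (u c \<bullet> i) * \<tau> m (tvec_of M c m i) v)"
    using \<tau> m v by (intro linear_form_coords[OF M _ u c]) (simp add: bilinear_field_def)
  also have "\<dots> = (\<Sum>i\<in>Axes. (u c \<bullet> i) * (\<Sum>j\<in>Axes. (v c \<bullet> j) * tensor_coord M \<tau> c m i j))"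
  proof (intro sum.cong refl arg_cong2[where f = "(*)"])
    fix i :: 'b
    show "\<tau> m (tvec_of M c m i) v = (\<Sum>j\<in>Axes. (v c \<bullet> j) * tensor_coord M \<tau> c m i j)"
      unfolding tensor_coord_def
      using \<tau> m tvec_of_in_tangent_space[OF M c]
      by (intro linear_form_coords[OF M _ v c]) (simp add: bilinear_field_def)
  qed
  finally show ?thesis by (simp add: sum_distrib_left)
qed

text \<open>
  The second slot of \<open>\<tau>\<close> carries \<open>v\<close>, since the components of the covector are \<open>\<tau>\<^sub>i\<^sub>j v\<^sup>j\<close>; for a field that is
  not symmetric the order matters.
\<close>

lemma flat_apply:
  assumes M: "smooth_manifold M" and \<tau>: "bilinear_field M \<tau>" and m: "m \<in> points M"
    and v: "v \<in> tangent_space M m" and w: "w \<in> tangent_space M m"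
  shows "flat M \<tau> m v w = \<tau> m w v"
  using tensor_coords[OF M \<tau> some_chart_in[OF M m] w v] w
  by (simp add: flat_def Let_def sum_distrib_left sum_distrib_right mult_ac)

lemma mat_inverse:
  assumes "nondegenerate M \<tau>" "smooth_manifold M" "c \<in> charts_at M m"
  shows "inverse_matrices (tensor_coord M \<tau> c m) (mat_inverse (tensor_coord M \<tau> c m))"
  unfolding mat_inverse_def using assms charts_at_imp_point[OF assms(2,3)]
  by (intro someI_ex[of "inverse_matrices (tensor_coord M \<tau> c m)"]) (auto simp: nondegenerate_def)

text \<open>
  Multiplication by one matrix undoes multiplication by the other.
\<close>

lemma inverse_matrices_solve:
  assumes "inverse_matrices A B" "i \<in> Axes"
  shows "(\<Sum>j\<in>Axes. A i j * (\<Sum>k\<in>Axes. B j k * x k)) = x i"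
    and "(\<Sum>j\<in>Axes. B i j * (\<Sum>k\<in>Axes. A j k * x k)) = x i"
proof -
  have *: "(\<Sum>j\<in>Axes. A i j * (\<Sum>k\<in>Axes. B j k * x k)) = x i"
    if "\<And>k. k \<in> Axes \<Longrightarrow> (\<Sum>j\<in>Axes. A i j * B j k) = (if i = k then 1 else 0)" for A B :: "'a \<Rightarrow> 'a \<Rightarrow> real"
  proof -
    have "(\<Sum>j\<in>Axes. A i j * (\<Sum>k\<in>Axes. B j k * x k)) = (\<Sum>k\<in>Axes. (\<Sum>j\<in>Axes. A i j * B j k) * x k)"
      by (simp add: sum_distrib_left sum_distrib_right mult.assoc) (rule sum.swap)
    also have "\<dots> = (\<Sum>k\<in>Axes. (if i = k then 1 else 0) * x k)"
      using that by (intro sum.cong) auto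
    also have "\<dots> = x i"
      using assms(2) by (simp add: finite_Axes if_distrib[where f = "\<lambda>c. c * _"] cong: if_cong)
    finally show ?thesis .
  qed
  show "(\<Sum>j\<in>Axes. A i j * (\<Sum>k\<in>Axes. B j k * x k)) = x i"
    and "(\<Sum>j\<in>Axes. B i j * (\<Sum>k\<in>Axes. A j k * x k)) = x i"
    using assms by (intro *; simp add: inverse_matrices_def)+
qed

lemma inner_sum_Axes: "i \<in> Axes \<Longrightarrow> (\<Sum>j\<in>Axes. x j *\<^sub>R j) \<bullet> i = x i"
  by (simp add: inner_sum_left inner_Axes finite_Axes if_distrib cong: if_cong)

text \<open>
  Uniqueness of the vector that represents a form, together with its coordinates in \<^emph>\<open>every\<close> chart:
  testing \<open>\<tau>(u, w) = l(u)\<close> on the coordinate vectors of \<open>c\<close> gives a linear system with the matrix of \<open>\<tau>\<close>.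
\<close>

lemma represented_coords:
  assumes M: "smooth_manifold M" and \<tau>: "bilinear_field M \<tau>" "nondegenerate M \<tau>"
    and c: "c \<in> charts_at M m" and w: "w \<in> tangent_space M m"
    and l: "\<And>u. u \<in> tangent_space M m \<Longrightarrow> \<tau> m u w = l u"
  shows "w c = (\<Sum>i\<in>Axes. (\<Sum>j\<in>Axes. mat_inverse (tensor_coord M \<tau> c m) i j * l (tvec_of M c m j)) *\<^sub>R i)"
proof -
  let ?A = "tensor_coord M \<tau> c m"
  have "l (tvec_of M c m j) = (\<Sum>k\<in>Axes. ?A j k * (w c \<bullet> k))" for j
  proof -
    have t: "tvec_of M c m j \<in> tangent_space M m"
      using M c by (rule tvec_of_in_tangent_space)
    have "linear_form M m (\<tau> m (tvec_of M c m j))"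
      using \<tau>(1) t charts_at_imp_point[OF M c] by (simp add: bilinear_field_def)
    from linear_form_coords[OF M this w c] show ?thesis
      using l[OF t] by (simp add: tensor_coord_def mult.commute)
  qed
  then have "(\<Sum>j\<in>Axes. mat_inverse ?A i j * l (tvec_of M c m j)) = w c \<bullet> i" if "i \<in> Axes" for i
    using inverse_matrices_solve(2)[OF mat_inverse[OF \<tau>(2) M c] that] by simp
  then show ?thesis
    by (simp add: sum_Axes_components)
qed

text \<open>
  Existence of the representing vector. Together with \<open>represented_coords\<close> it frees \<open>sharp\<close> from
  the chart chosen in its definition.
\<close>

lemma sharp_represents:
  assumes M: "smooth_manifold M" and \<tau>: "bilinear_field M \<tau>" "nondegenerate M \<tau>"
    and m: "m \<in> points M" and l: "linear_form M m l" and u: "u \<in> tangent_space M m"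
  shows "\<tau> m u (sharp M \<tau> m l) = l u"
proof -
  let ?c = "some_chart M m"
  let ?A = "tensor_coord M \<tau> ?c m" and ?B = "mat_inverse (tensor_coord M \<tau> ?c m)"
  let ?l = "\<lambda>i. l (tvec_of M ?c m i)"
  have c: "?c \<in> charts_at M m" using M m by (rule some_chart_in)
  have w: "sharp M \<tau> m l \<in> tangent_space M m"
    unfolding sharp_def Let_def using M c by (rule tvec_of_in_tangent_space)
  have wc: "sharp M \<tau> m l ?c \<bullet> j = (\<Sum>k\<in>Axes. ?B j k * ?l k)" if "j \<in> Axes" for j
    using that by (simp add: sharp_def Let_def tvec_of_self[OF M c] inner_sum_Axes)
  have "\<tau> m u (sharp M \<tau> m l) = (\<Sum>i\<in>Axes. (u ?c \<bullet> i) * (\<Sum>j\<in>Axes. ?A i j * (\<Sum>k\<in>Axes. ?B j k * ?l k)))"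
    unfolding tensor_coords[OF M \<tau>(1) c u w]
    by (simp add: wc sum_distrib_left mult_ac)
  also have "\<dots> = (\<Sum>i\<in>Axes. (u ?c \<bullet> i) * ?l i)"
    using inverse_matrices_solve(1)[OF mat_inverse[OF \<tau>(2) M c]] by simp
  also have "\<dots> = l u"
    using linear_form_coords[OF M l u c] by simp
  finally show ?thesis .
qed

lemma sharp_in_tangent_space:
  "smooth_manifold M \<Longrightarrow> m \<in> points M \<Longrightarrow> sharp M \<tau> m l \<in> tangent_space M m"
  unfolding sharp_def Let_def by (intro tvec_of_in_tangent_space some_chart_in)

section \<open>The topology of the tangent bundle\<close>

lemma mem_chart_image_iff:
  assumes "smooth_manifold M" "c \<in> charts_at M m"
  shows "snd c m \<in> snd c ` (fst c \<inter> P) \<longleftrightarrow> m \<in> P"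
proof -
  have "snd c m \<in> snd c ` (fst c \<inter> P) \<longleftrightarrow> m \<in> fst c \<inter> P"
    using assms by (intro inj_on_image_mem_iff[OF chart_inj_on]) (auto simp: charts_at_iff)
  then show ?thesis using assms(2) by (simp add: charts_at_iff)
qed

lemma openin_tangent_bundle:
  assumes "c \<in> atlas M" "open W"
  shows "openin (mtop (tangent_bundle M))
    {p \<in> fst (tangent_chart M c). snd (tangent_chart M c) p \<in> W}"
proof -
  have "openin (topology_generated_by {{p \<in> fst k. snd k p \<in> W} | k W. k \<in> tangent_chart M ` atlas M \<and> open W})
    {p \<in> fst (tangent_chart M c). snd (tangent_chart M c) p \<in> W}"
    using assms by (intro topology_generated_by_Basis) blast
  then show ?thesis by (simp add: tangent_bundle_def Let_def)
qed

lemma topspace_tangent_bundle: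
  assumes "smooth_manifold M"
  shows "points (tangent_bundle M) = Sigma (points M) (tangent_space M)"
proof -
  have "points (tangent_bundle M) = (\<Union>c\<in>atlas M. fst (tangent_chart M c))"
  proof
    show "points (tangent_bundle M) \<subseteq> (\<Union>c\<in>atlas M. fst (tangent_chart M c))"
      unfolding tangent_bundle_def Let_def manifold.simps topology_generated_by_topspace by blast
    show "(\<Union>c\<in>atlas M. fst (tangent_chart M c)) \<subseteq> points (tangent_bundle M)"
      using openin_subset[OF openin_tangent_bundle[OF _ open_UNIV]] by fastforce
  qed
  moreover have "points M = (\<Union>c\<in>atlas M. fst c)"
    using assms by (simp only: smooth_manifold_def)
  ultimately show ?thesis
    by (auto simp: tangent_chart_def)
qed

section \<open>The Galerkin reduction of a tangent vector\<close>

text \<open>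
  The data of a reduction; \<open>\<tau>'\<close>, the field that \<open>\<phi>\<close> induces on \<open>N\<close>, is abbreviated below.
\<close>

locale gmg =
  fixes M :: "('a, 'e::cartesian_space) manifold"
    and N :: "('b, 'f::cartesian_space) manifold"
    and \<tau> :: "('a, 'e) tensor02"
    and \<phi> :: "'b \<Rightarrow> 'a"
    and \<rho> :: "'a \<Rightarrow> 'b"
  assumes M: "smooth_manifold M"
    and N: "smooth_manifold N"
    and \<tau>: "smooth_tensor_field M \<tau>"
    and \<phi>: "smooth_map N M \<phi>"
    and nondeg: "nondegenerate N (pullback_tensor N M \<phi> \<tau>)"
    and \<rho>: "smooth_map M N \<rho>"
    and \<rho>_\<phi>: "\<And>n. n \<in> points N \<Longrightarrow> \<rho> (\<phi> n) = n"
begin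

abbreviation "d\<phi> \<equiv> differential N M \<phi>"
abbreviation "\<tau>' \<equiv> pullback_tensor N M \<phi> \<tau>"

definition reduced :: "'b \<Rightarrow> ('a, 'e) tvec \<Rightarrow> ('b, 'f) tvec" where
  "reduced n v = sharp N \<tau>' n (pullback_covec N M \<phi> n (flat M \<tau> (\<phi> n) v))"

lemma \<tau>_bilinear: "bilinear_field M \<tau>"
  using \<tau> by (rule smooth_tensor_field_bilinear)

lemmas d\<phi>_in = differential_in_tangent_space[OF N M \<phi>]

lemma linear_form_pullback:
  assumes "n \<in> points N" "linear_form M (\<phi> n) l"
  shows "linear_form N n (\<lambda>u. l (d\<phi> n u))"
  using assms(2) by (simp add: linear_form_def differential_lincomb[OF N M \<phi> assms(1)] d\<phi>_in[OF assms(1)])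

lemma \<tau>'_bilinear: "bilinear_field N \<tau>'"
  unfolding bilinear_field_def pullback_tensor_def
  using \<tau>_bilinear by (intro ballI conjI linear_form_pullback)
    (auto simp: bilinear_field_def d\<phi>_in smooth_map_in[OF \<phi>])

lemma reduced_in: "n \<in> points N \<Longrightarrow> reduced n v \<in> tangent_space N n"
  unfolding reduced_def by (rule sharp_in_tangent_space[OF N])

text \<open>
  The Galerkin condition: the reduced vector \<open>w\<close> satisfies \<open>\<tau>(d\<phi> u, d\<phi> w) = \<tau>(d\<phi> u, v)\<close> for all test
  vectors \<open>u\<close> on \<open>N\<close>, i.e. the residual \<open>d\<phi> w - v\<close> is annihilated by \<open>\<tau>(d\<phi> u, \<cdot>)\<close>.
\<close>

lemma reduced_represents:
  assumes n: "n \<in> points N" and v: "v \<in> tangent_space M (\<phi> n)" and u: "u \<in> tangent_space N n"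
  shows "\<tau>' n u (reduced n v) = \<tau> (\<phi> n) (d\<phi> n u) v"
proof -
  let ?l = "pullback_covec N M \<phi> n (flat M \<tau> (\<phi> n) v)"
  have l: "?l u = \<tau> (\<phi> n) (d\<phi> n u) v" if "u \<in> tangent_space N n" for u
    using that flat_apply[OF M \<tau>_bilinear smooth_map_in[OF \<phi> n] v] d\<phi>_in[OF n]
    by (simp add: pullback_covec_def)
  have "linear_form N n (\<lambda>u. \<tau> (\<phi> n) (d\<phi> n u) v)"
    using \<tau>_bilinear v smooth_map_in[OF \<phi> n]
    by (intro linear_form_pullback[OF n]) (auto simp: bilinear_field_def)
  then have "linear_form N n ?l"
    using tangent_space_lincomb[OF N n] by (simp add: linear_form_def l)
  then show ?thesis
    using sharp_represents[OF N \<tau>'_bilinear nondeg n _ u] l[OF u] by (simp add: reduced_def)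
qed

text \<open>
  Both \<open>v\<close> and the reduction of \<open>d\<phi> v\<close> solve the Galerkin condition for \<open>d\<phi> v\<close>, and the solution is unique.
\<close>

lemma reduced_d\<phi>:
  assumes n: "n \<in> points N" and v: "v \<in> tangent_space N n"
  shows "reduced n (d\<phi> n v) = v"
proof -
  have c: "some_chart N n \<in> charts_at N n" using N n by (rule some_chart_in)
  have "\<tau>' n u (reduced n (d\<phi> n v)) = \<tau>' n u v" if "u \<in> tangent_space N n" for u
    using reduced_represents[OF n d\<phi>_in[OF n v] that] by (simp add: pullback_tensor_def)
  from represented_coords[OF N \<tau>'_bilinear nondeg c reduced_in[OF n] this]
    represented_coords[OF N \<tau>'_bilinear nondeg c v refl]
  show ?thesis
    by (intro tangent_eqI[OF reduced_in[OF n] v c]) simp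
qed

lemma gmg_reduction_\<phi>: "n \<in> points N \<Longrightarrow> gmg_reduction N M \<phi> \<tau> \<rho> (\<phi> n, v) = (n, reduced n v)"
  by (simp add: gmg_reduction_def reduced_def \<rho>_\<phi>)

section \<open>Coordinates of the reduction\<close>

text \<open>
  The open set of coordinates on which the chart \<open>d\<close> of \<open>N\<close> and the chart \<open>c\<close> of \<open>M\<close> together describe
  \<open>\<phi>\<close>; the functions of \<open>y\<close> defined next are meaningful and smooth there.
\<close>

definition overlap :: "('b, 'f) chart \<Rightarrow> ('a, 'e) chart \<Rightarrow> 'f set" where
  "overlap d c = snd d ` (fst d \<inter> \<phi> -` fst c)"

lemma overlapE:
  assumes "d \<in> atlas N" "c \<in> atlas M" "y \<in> overlap d c"
  obtains n where "n \<in> points N" "d \<in> charts_at N n" "c \<in> charts_at M (\<phi> n)" "y = snd d n"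
proof -
  from assms(3) obtain n where "n \<in> fst d" "\<phi> n \<in> fst c" "y = snd d n"
    by (auto simp: overlap_def)
  with assms show ?thesis
    by (intro that[of n] charts_at_imp_point[OF N, of d]) (auto simp: charts_at_iff)
qed

lemma open_overlap: "d \<in> atlas N \<Longrightarrow> c \<in> atlas M \<Longrightarrow> open (overlap d c)"
  unfolding overlap_def using \<phi>
  by (intro open_chart_preimage[OF N _ _ chart_openin[OF M]]) (auto simp: smooth_map_def)

definition \<tau>_rep :: "('b, 'f) chart \<Rightarrow> ('a, 'e) chart \<Rightarrow> 'f \<Rightarrow> 'e \<Rightarrow> 'e \<Rightarrow> real" where
  "\<tau>_rep d c y k l = tensor_coord M \<tau> c (chart_inv c (chart_rep d \<phi> c y)) k l"

definition \<phi>_deriv :: "('b, 'f) chart \<Rightarrow> ('a, 'e) chart \<Rightarrow> 'f \<Rightarrow> 'f \<Rightarrow> 'e" where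
  "\<phi>_deriv d c y i = frechet_derivative (chart_rep d \<phi> c) (at y) i"

definition \<tau>'_rep :: "('b, 'f) chart \<Rightarrow> 'f \<Rightarrow> 'f \<Rightarrow> 'f \<Rightarrow> real" where
  "\<tau>'_rep d y i j = tensor_coord N \<tau>' d (chart_inv d y) i j"

text \<open>
  The inverse matrix of \<open>\<tau>'\<close>, applied to the components \<open>\<tau>(d\<phi> \<partial>\<^sub>j, v)\<close> of the pulled back covector, where \<open>x\<close>
  holds the coordinates of \<open>v\<close>.
\<close>

definition reduced_rep :: "('b, 'f) chart \<Rightarrow> ('a, 'e) chart \<Rightarrow> 'f \<times> 'e \<Rightarrow> 'f" where
  "reduced_rep d c = (\<lambda>(y, x). \<Sum>i\<in>Axes. (\<Sum>j\<in>Axes. mat_inverse (\<tau>'_rep d y) i j *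
     (\<Sum>k\<in>Axes. \<Sum>l\<in>Axes. (\<phi>_deriv d c y j \<bullet> k) * ((x \<bullet> l) * \<tau>_rep d c y k l))) *\<^sub>R i)"

context
  fixes d :: "('b, 'f) chart" and c :: "('a, 'e) chart"
  assumes d: "d \<in> atlas N" and c: "c \<in> atlas M"
begin

lemma smooth_\<phi>_rep: "smooth_on (chart_rep d \<phi> c) (overlap d c)"
  using \<phi> d c by (simp add: smooth_map_def overlap_def)

lemma smooth_\<phi>_deriv: "smooth_on (\<lambda>y. \<phi>_deriv d c y i) (overlap d c)"
  unfolding \<phi>_deriv_def by (rule smooth_on_frechet_derivative[OF smooth_\<phi>_rep])

lemma smooth_\<tau>_rep:
  assumes "k \<in> Axes" "l \<in> Axes"
  shows "smooth_on (\<lambda>y. \<tau>_rep d c y k l) (overlap d c)"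
  unfolding \<tau>_rep_def
proof (rule smooth_on_compose[OF _ smooth_\<phi>_rep open_overlap[OF d c]])
  show "smooth_on (\<lambda>x. tensor_coord M \<tau> c (chart_inv c x) k l) (snd c ` fst c)"
    using \<tau> c assms by (simp add: smooth_tensor_field_def)
  show "chart_rep d \<phi> c ` overlap d c \<subseteq> snd c ` fst c"
    using chart_rep_chart[OF N, of d _ \<phi> c] d
    by (auto simp: overlap_def charts_at_iff)
qed

lemma \<tau>_rep_chart:
  assumes "d \<in> charts_at N n" "c \<in> charts_at M (\<phi> n)"
  shows "\<tau>_rep d c (snd d n) = tensor_coord M \<tau> c (\<phi> n)"
  using assms by (simp add: \<tau>_rep_def fun_eq_iff chart_rep_chart[OF N] chart_inv_chart[OF M])

lemma \<phi>_deriv_chart: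
  assumes "d \<in> charts_at N n" "c \<in> charts_at M (\<phi> n)"
  shows "d\<phi> n (tvec_of N d n i) c = \<phi>_deriv d c (snd d n) i"
  using differential_coords[OF N M \<phi> assms tvec_of_in_tangent_space[OF N assms(1)]]
  by (simp add: \<phi>_deriv_def tvec_of_self[OF N assms(1)])

text \<open>
  The matrix of \<open>\<tau>'\<close> is \<open>J\<^sup>T T J\<close>, with the Jacobian \<open>J\<close> of \<open>\<phi>\<close> and the matrix \<open>T\<close> of \<open>\<tau>\<close>. This exhibits it
  as a smooth function of \<open>y\<close>.
\<close>

lemma \<tau>'_rep_eq:
  assumes "y \<in> overlap d c"
  shows "\<tau>'_rep d y i j =
    (\<Sum>k\<in>Axes. \<Sum>l\<in>Axes. (\<phi>_deriv d c y i \<bullet> k) * ((\<phi>_deriv d c y j \<bullet> l) * \<tau>_rep d c y k l))"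
proof -
  obtain n where n: "n \<in> points N" "d \<in> charts_at N n" "c \<in> charts_at M (\<phi> n)" "y = snd d n"
    using overlapE[OF d c assms] .
  show ?thesis
    using tensor_coords[OF M \<tau>_bilinear n(3), of "d\<phi> n (tvec_of N d n i)" "d\<phi> n (tvec_of N d n j)"]
    by (simp add: \<tau>'_rep_def tensor_coord_def[of N] pullback_tensor_def n(4) chart_inv_chart[OF N n(2)]
        \<phi>_deriv_chart[OF n(2,3)] \<tau>_rep_chart[OF n(2,3)] d\<phi>_in[OF n(1)] tvec_of_in_tangent_space[OF N n(2)])
qed

lemma smooth_\<tau>'_rep_inverse:
  assumes "i \<in> Axes" "j \<in> Axes"
  shows "smooth_on (\<lambda>y. mat_inverse (\<tau>'_rep d y) i j) (overlap d c)"
proof (rule smooth_on_matrix_inverse[OF open_overlap[OF d c] _ _ assms])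
  fix i j
  have "smooth_on (\<lambda>y. \<Sum>k\<in>Axes. \<Sum>l\<in>Axes. (\<phi>_deriv d c y i \<bullet> k) * ((\<phi>_deriv d c y j \<bullet> l) * \<tau>_rep d c y k l))
    (overlap d c)"
    by (intro smooth_on_sum smooth_on_bilinear[OF bounded_bilinear_mult] open_overlap[OF d c]
      smooth_on_linear_comp[OF bounded_linear_inner_left] smooth_\<phi>_deriv smooth_\<tau>_rep)
  then show "smooth_on (\<lambda>y. \<tau>'_rep d y i j) (overlap d c)"
    by (rule smooth_on_cong[OF _ open_overlap[OF d c]]) (simp add: \<tau>'_rep_eq)
next
  fix y assume "y \<in> overlap d c"
  from overlapE[OF d c this] obtain n where n: "d \<in> charts_at N n" "y = snd d n" by blast
  have "\<tau>'_rep d y = tensor_coord N \<tau>' d n"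
    by (simp add: fun_eq_iff \<tau>'_rep_def n(2) chart_inv_chart[OF N n(1)])
  then show "inverse_matrices (\<tau>'_rep d y) (mat_inverse (\<tau>'_rep d y))"
    using mat_inverse[OF nondeg N n(1)] by simp
qed

lemma open_overlap_times: "open (overlap d c \<times> (UNIV :: 'e set))"
  by (intro open_Times open_overlap d c open_UNIV)

lemma smooth_on_fst_overlap:
  "smooth_on f (overlap d c) \<Longrightarrow> smooth_on (\<lambda>p. f (fst p)) (overlap d c \<times> (UNIV :: 'e set))"
  by (rule smooth_on_compose[OF _ smooth_on_linear[OF bounded_linear_fst]]) (auto intro: open_overlap_times)

lemma smooth_reduced_rep: "smooth_on (reduced_rep d c) (overlap d c \<times> UNIV)"
proof -
  have x: "smooth_on (\<lambda>p. snd p \<bullet> l) (overlap d c \<times> UNIV)" for l :: 'e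
    by (rule smooth_on_linear_comp[OF bounded_linear_inner_left open_overlap_times
        smooth_on_linear[OF bounded_linear_snd open_overlap_times]])
  show ?thesis
    unfolding reduced_rep_def case_prod_unfold
    by (intro smooth_on_sum open_overlap_times smooth_on_bilinear[OF bounded_bilinear_mult]
        smooth_on_linear_comp[OF bounded_linear_scaleR_left] x
        smooth_on_fst_overlap[OF smooth_\<tau>'_rep_inverse] smooth_on_fst_overlap[OF smooth_\<tau>_rep]
        smooth_on_fst_overlap[OF smooth_on_linear_comp[OF bounded_linear_inner_left
          open_overlap[OF d c] smooth_\<phi>_deriv]])
qed

text \<open>
  The solution of the Galerkin condition in arbitrary charts \<open>d\<close> and \<open>c\<close>, independently of those that
  the definition of the reduction picks at \<open>n\<close> and \<open>\<phi> n\<close>.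
\<close>

lemma reduced_rep_chart:
  assumes n: "d \<in> charts_at N n" "c \<in> charts_at M (\<phi> n)" and v: "v \<in> tangent_space M (\<phi> n)"
  shows "reduced n v d = reduced_rep d c (snd d n, v c)"
proof -
  have pt: "n \<in> points N" using charts_at_imp_point[OF N n(1)] .
  have "\<tau>'_rep d (snd d n) = tensor_coord N \<tau>' d n"
    by (simp add: fun_eq_iff \<tau>'_rep_def chart_inv_chart[OF N n(1)])
  moreover have "\<tau> (\<phi> n) (d\<phi> n (tvec_of N d n j)) v = (\<Sum>k\<in>Axes. \<Sum>l\<in>Axes.
      (\<phi>_deriv d c (snd d n) j \<bullet> k) * ((v c \<bullet> l) * \<tau>_rep d c (snd d n) k l))" for j
    using tensor_coords[OF M \<tau>_bilinear n(2) _ v, of "d\<phi> n (tvec_of N d n j)"]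
    by (simp add: \<phi>_deriv_chart[OF n] \<tau>_rep_chart[OF n] d\<phi>_in[OF pt] tvec_of_in_tangent_space[OF N n(1)])
  ultimately show ?thesis
    using represented_coords[OF N \<tau>'_bilinear nondeg n(1) reduced_in[OF pt] reduced_represents[OF pt v]]
    by (simp add: reduced_rep_def)
qed

lemma smooth_reduction_rep:
  "smooth_on (\<lambda>(y, x). (y, reduced_rep d c (y, x))) (overlap d c \<times> UNIV)"
  using smooth_on_Pair[OF open_overlap_times smooth_on_linear[OF bounded_linear_fst open_overlap_times]
      smooth_reduced_rep]
  by (simp add: case_prod_unfold)

end

section \<open>Smoothness of the reduction\<close>

abbreviation "S \<equiv> embedded_image N M \<phi>"
abbreviation "E \<equiv> restricted_tangent_bundle M S"
abbreviation "R \<equiv> gmg_reduction N M \<phi> \<tau> \<rho>"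

lemma points_E: "points E = Sigma (\<phi> ` points N) (tangent_space M)"
  using smooth_map_in[OF \<phi>]
  by (auto simp: restricted_tangent_bundle_def embedded_image_def topspace_tangent_bundle[OF M])

text \<open>
  For a basic open set given by a chart \<open>d\<close> of \<open>N\<close> and a set \<open>W\<close> of coordinates, and a chart \<open>c\<close> of \<open>M\<close>, the
  coordinate expression of the reduction pulls \<open>W\<close> back to an open set \<open>V\<close> of pairs \<open>(y, x)\<close>. Substituting
  for \<open>y\<close> the coordinate of \<open>\<rho>(m)\<close>, which is defined and continuous on an open part of \<open>M\<close> and not only
  on the image of \<open>\<phi>\<close>, turns \<open>V\<close> into an open set of \<open>TM\<close> that cuts out the preimage.
\<close>

lemma continuous_R: "continuous_map (mtop E) (mtop (tangent_bundle N)) R"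
proof -
  have "openin (mtop E) (R -` {p \<in> fst (tangent_chart N d). snd (tangent_chart N d) p \<in> W} \<inter> points E)"
    (is "openin _ (R -` ?U \<inter> _)") if d: "d \<in> atlas N" and W: "open W" for d W
  proof -
    define V where "V c = (overlap d c \<times> UNIV) \<inter> (\<lambda>(y, x). (y, reduced_rep d c (y, x))) -` W" for c
    define X where "X c = snd c ` (fst c \<inter> \<rho> -` fst d)" for c :: "('a, 'e) chart"
    define W' where "W' c = (X c \<times> UNIV) \<inter> (\<lambda>q. (chart_rep c \<rho> d (fst q), snd q)) -` V c" for c
    define O' where "O' c = {p \<in> fst (tangent_chart M c). snd (tangent_chart M c) p \<in> W' c}" for c
    have "openin (mtop (tangent_bundle M)) (O' c)" if c: "c \<in> atlas M" for c
      unfolding O'_def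
    proof (rule openin_tangent_bundle[OF c])
      have V: "open (V c)"
        unfolding V_def using smooth_on_imp_continuous_on[OF smooth_reduction_rep[OF d c]]
        by (rule continuous_open_preimage[OF _ open_overlap_times[OF d c] W])
      have X: "open (X c)"
        unfolding X_def using \<rho>
        by (intro open_chart_preimage[OF M c _ chart_openin[OF N d]]) (simp add: smooth_map_def)
      have "continuous_on (X c) (chart_rep c \<rho> d)"
        using \<rho> c d by (intro smooth_on_imp_continuous_on) (simp add: smooth_map_def X_def)
      then have "continuous_on (X c \<times> UNIV) (\<lambda>q. (chart_rep c \<rho> d (fst q), snd q))"
        by (intro continuous_on_Pair[OF continuous_on_compose2[OF _ continuous_on_fst[OF continuous_on_id]]
            continuous_on_snd[OF continuous_on_id]]) auto
      then show "open (W' c)"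
        unfolding W'_def by (rule continuous_open_preimage[OF _ open_Times[OF X open_UNIV] V])
    qed
    then have "openin (mtop (tangent_bundle M)) (\<Union>c\<in>atlas M. O' c)"
      by auto
    moreover have "R -` ?U \<inter> points E = (\<Union>c\<in>atlas M. O' c) \<inter> points E"
    proof -
      \<comment> \<open>When \<open>d\<close> is not a chart at \<open>n\<close>, the constraint by \<open>X c\<close> excludes \<open>p\<close> on the right as well.\<close>
      have *: "R p \<in> ?U \<longleftrightarrow> p \<in> O' c"
        if nv: "n \<in> points N" "v \<in> tangent_space M (\<phi> n)" "p = (\<phi> n, v)" and c: "c \<in> charts_at M (\<phi> n)"
        for p n v c
      proof (cases "d \<in> charts_at N n")
        case True
        have "snd c (\<phi> n) \<in> X c"
          using True mem_chart_image_iff[OF M c] by (simp add: X_def charts_at_iff \<rho>_\<phi>[OF nv(1)])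
        moreover have "snd d n \<in> overlap d c"
          using True c by (simp add: overlap_def charts_at_iff)
        moreover have "reduced n v d = reduced_rep d c (snd d n, v c)"
          using c by (intro reduced_rep_chart d True nv) (simp add: charts_at_iff)
        ultimately show ?thesis
          using True c nv d
          by (simp add: gmg_reduction_\<phi> O'_def W'_def V_def tangent_chart_def charts_at_iff
              reduced_in chart_rep_chart[OF M c] \<rho>_\<phi>)
      next
        case False
        then have "n \<notin> fst d" using d by (simp add: charts_at_iff)
        moreover from this have "snd c (\<phi> n) \<notin> X c"
          using mem_chart_image_iff[OF M c] by (simp add: X_def \<rho>_\<phi>[OF nv(1)])
        ultimately show ?thesis
          using nv by (simp add: gmg_reduction_\<phi> O'_def W'_def tangent_chart_def)
      qed
      show ?thesis
      proof (intro set_eqI iffI)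
        fix p assume p: "p \<in> R -` ?U \<inter> points E"
        then obtain n v where nv: "n \<in> points N" "v \<in> tangent_space M (\<phi> n)" "p = (\<phi> n, v)"
          unfolding points_E by auto
        have c: "some_chart M (\<phi> n) \<in> charts_at M (\<phi> n)"
          using M smooth_map_in[OF \<phi> nv(1)] by (rule some_chart_in)
        with p *[OF nv c] show "p \<in> (\<Union>c\<in>atlas M. O' c) \<inter> points E"
          by (auto simp: charts_at_iff)
      next
        fix p assume p: "p \<in> (\<Union>c\<in>atlas M. O' c) \<inter> points E"
        then obtain n v where nv: "n \<in> points N" "v \<in> tangent_space M (\<phi> n)" "p = (\<phi> n, v)"
          unfolding points_E by auto
        from p obtain c where c: "c \<in> atlas M" "p \<in> O' c" by auto
        then have "c \<in> charts_at M (\<phi> n)"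
          using nv by (simp add: O'_def tangent_chart_def charts_at_iff)
        from *[OF nv this] c p show "p \<in> R -` ?U \<inter> points E" by auto
      qed
    qed
    moreover have "mtop E = subtopology (mtop (tangent_bundle M)) (points E)"
      by (simp add: restricted_tangent_bundle_def subtopology_restrict)
    ultimately show ?thesis
      using openin_subtopology_Int[of "mtop (tangent_bundle M)" "\<Union>c\<in>atlas M. O' c" "points E"]
      by (simp only:)
  qed
  moreover have "R ` points E \<subseteq> points (tangent_bundle N)"
    unfolding points_E topspace_tangent_bundle[OF N] using gmg_reduction_\<phi> reduced_in by auto
  ultimately show ?thesis
    unfolding tangent_bundle_def[of N] Let_def manifold.simps continuous_on_generated_topo_iff
      topology_generated_by_topspace
    by blast
qed

text \<open>
  In a chart of the restricted bundle, built from \<open>d\<close> and \<open>c\<close>, and the chart of \<open>TN\<close> induced by \<open>d'\<close>, the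
  reduction is the transition from \<open>d\<close> to \<open>d'\<close> in the base coordinate, followed by the coordinate
  expression of the reduction in \<open>d'\<close> and \<open>c\<close>.
\<close>

lemma smooth_R: "smooth_map E (tangent_bundle N) R"
  unfolding smooth_map_def
proof (intro conjI ballI continuous_R)
  fix k k' assume "k \<in> atlas E" "k' \<in> atlas (tangent_bundle N)"
  then obtain d c d' where d: "d \<in> atlas N" and c: "c \<in> atlas M" and d': "d' \<in> atlas N"
    and k: "k = (Sigma (\<phi> ` fst d \<inter> fst c) (tangent_space M),
        \<lambda>(m, v). (snd d (inv_into (points N) \<phi> m), v c))"
    and k': "k' = tangent_chart N d'"
    by (auto simp: restricted_tangent_bundle_def embedded_image_def tangent_bundle_def Let_def)
  have inv_\<phi>: "inv_into (points N) \<phi> (\<phi> n) = n" if "n \<in> points N" for n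
    using that \<rho>_\<phi> by (intro inv_into_f_f inj_on_inverseI)
  have pt: "n \<in> points N" if "n \<in> fst d" for n
    using that d charts_at_imp_point[OF N] by (simp add: charts_at_iff)
  define Y where "Y = snd d ` (fst d \<inter> (\<phi> -` fst c \<inter> fst d'))"
  have openY: "open (Y \<times> (UNIV :: 'e set))"
  proof -
    have "Y = overlap d c \<inter> snd d ` (fst d \<inter> fst d')"
      using inj_on_image_Int[OF chart_inj_on[OF N d], of "fst d \<inter> \<phi> -` fst c" "fst d \<inter> fst d'"]
      by (simp add: Y_def overlap_def Int_ac)
    moreover have "open (snd d ` (fst d \<inter> fst d'))"
      by (rule open_chart_image[OF N d openin_Int[OF chart_openin[OF N d] chart_openin[OF N d']]]) auto
    ultimately show ?thesis
      using open_overlap[OF d c] by (simp add: open_Times open_Int)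
  qed
  have k_inj: "inj_on (snd k) (fst k)"
  proof (rule inj_onI)
    fix p q assume pq: "p \<in> fst k" "q \<in> fst k" "snd k p = snd k q"
    then obtain n v n' v' where p: "p = (\<phi> n, v)" "n \<in> fst d" "\<phi> n \<in> fst c" "v \<in> tangent_space M (\<phi> n)"
      and q: "q = (\<phi> n', v')" "n' \<in> fst d" "\<phi> n' \<in> fst c" "v' \<in> tangent_space M (\<phi> n')"
      unfolding k by auto
    with pq(3) have "snd d n = snd d n'" and vc: "v c = v' c"
      by (simp_all add: k inv_\<phi> pt)
    with p q have "n = n'" using chart_inj_on[OF N d] by (auto dest: inj_onD)
    moreover have "v = v'"
      using p q vc c \<open>n = n'\<close> by (intro tangent_eqI[of v M "\<phi> n" v' c]) (auto simp: charts_at_iff)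
    ultimately show "p = q" using p q by simp
  qed
  have R_in: "R (\<phi> n, v) \<in> fst k' \<longleftrightarrow> n \<in> fst d'" if "n \<in> points N" for n v
    using that by (simp add: gmg_reduction_\<phi> k' tangent_chart_def reduced_in)
  have dom: "snd k ` (fst k \<inter> R -` fst k') = Y \<times> UNIV"
  proof (intro equalityI subsetI)
    fix z assume "z \<in> snd k ` (fst k \<inter> R -` fst k')"
    then obtain p where p: "p \<in> fst k" "R p \<in> fst k'" "z = snd k p" by blast
    then obtain n v where n: "p = (\<phi> n, v)" "n \<in> fst d" "\<phi> n \<in> fst c"
      unfolding k by auto
    then have "n \<in> fst d'" using p(2) R_in[OF pt[OF n(2)]] by simp
    with n have "snd d n \<in> Y" by (auto simp: Y_def)
    then show "z \<in> Y \<times> UNIV" using n by (simp add: p(3) k inv_\<phi> pt)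
  next
    fix z assume "z \<in> Y \<times> (UNIV :: 'e set)"
    then obtain n x where z: "z = (snd d n, x)" and n: "n \<in> fst d" "\<phi> n \<in> fst c" "n \<in> fst d'"
      by (auto simp: Y_def)
    let ?p = "(\<phi> n, tvec_of M c (\<phi> n) x)"
    have cc: "c \<in> charts_at M (\<phi> n)" using c n by (simp add: charts_at_iff)
    have "?p \<in> fst k \<inter> R -` fst k'"
      using n tvec_of_in_tangent_space[OF M cc] by (simp add: k R_in[unfolded k] pt)
    moreover have "snd k ?p = z"
      using n by (simp add: k inv_\<phi> pt z tvec_of_self[OF M cc])
    ultimately show "z \<in> snd k ` (fst k \<inter> R -` fst k')" by (metis imageI)
  qed
  let ?G = "\<lambda>(y, x). (y, reduced_rep d' c (y, x))"
  let ?T = "\<lambda>p. (transition d d' (fst p), snd p :: 'e)"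
  show "smooth_on (chart_rep k R k') (snd k ` (fst k \<inter> R -` fst k'))"
    unfolding dom
  proof (rule smooth_on_cong[OF _ openY])
    have Y: "transition d d' ` Y \<subseteq> overlap d' c"
      using chart_rep_chart[OF N, of d _ "\<lambda>n. n" d'] d by (auto simp: Y_def overlap_def charts_at_iff)
    have "smooth_on (transition d d') (snd d ` (fst d \<inter> fst d'))"
      using N d d' by (simp add: smooth_manifold_def)
    then have "smooth_on (transition d d') Y"
      by (rule smooth_on_subset) (auto simp: Y_def)
    then have "smooth_on (\<lambda>p. transition d d' (fst p)) (Y \<times> (UNIV :: 'e set))"
      by (rule smooth_on_compose[OF _ smooth_on_linear[OF bounded_linear_fst openY] openY]) auto
    then have "smooth_on ?T (Y \<times> UNIV)"
      by (rule smooth_on_Pair[OF openY _ smooth_on_linear[OF bounded_linear_snd openY]])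
    then show "smooth_on (\<lambda>p. ?G (?T p)) (Y \<times> UNIV)"
      using Y by (intro smooth_on_compose[OF smooth_reduction_rep[OF d' c] _ openY]) auto
  next
    fix z assume "z \<in> Y \<times> (UNIV :: 'e set)"
    then obtain p where p: "p \<in> fst k" "R p \<in> fst k'" "z = snd k p"
      unfolding dom[symmetric] by auto
    then obtain n v where pn: "p = (\<phi> n, v)" and n: "n \<in> fst d" "\<phi> n \<in> fst c" and v: "v \<in> tangent_space M (\<phi> n)"
      unfolding k by auto
    have n': "n \<in> fst d'" using p(2) R_in[OF pt[OF n(1)]] pn by simp
    have ch: "d \<in> charts_at N n" "d' \<in> charts_at N n" "c \<in> charts_at M (\<phi> n)"
      using n n' d d' c by (simp_all add: charts_at_iff)
    have "chart_rep k R k' z = snd k' (R p)"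
      by (simp add: chart_rep_def chart_inv_def p(3) inv_into_f_f[OF k_inj p(1)])
    also have "\<dots> = (snd d' n, reduced_rep d' c (snd d' n, v c))"
      by (simp add: pn gmg_reduction_\<phi> pt n k' tangent_chart_def reduced_rep_chart[OF d' c ch(2,3) v])
    also have "\<dots> = ?G (?T z)"
      by (simp add: p(3) pn k inv_\<phi> pt n chart_rep_chart[OF N ch(1)])
    finally show "?G (?T z) = chart_rep k R k' z" ..
  qed
qed

lemma reduction_map_gmg: "reduction_map N M \<phi> R"
  unfolding reduction_map_def
proof (intro conjI)
  show "smooth_map E (tangent_bundle N) R" by (rule smooth_R)
  show "\<exists>\<rho>' r. \<forall>m\<in>\<phi> ` points N. \<rho>' m \<in> points N \<and>
      (\<forall>v\<in>tangent_space M m. r m v \<in> tangent_space N (\<rho>' m) \<and> R (m, v) = (\<rho>' m, r m v))"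
    by (rule exI[of _ \<rho>], rule exI[of _ "\<lambda>m. reduced (\<rho> m)"])
      (auto simp: \<rho>_\<phi> gmg_reduction_\<phi> reduced_in)
  show "\<forall>p\<in>Sigma (points N) (tangent_space N). R (tangent_map N M \<phi> p) = p"
    by (auto simp: tangent_map_def gmg_reduction_\<phi> reduced_d\<phi>)
qed

end

theorem theorem5p3:
  fixes M :: "('a, 'e::cartesian_space) manifold"
    and N :: "('b, 'f::cartesian_space) manifold"
    and \<tau> :: "('a, 'e) tensor02"
    and \<phi> :: "'b \<Rightarrow> 'a"
    and \<rho> :: "'a \<Rightarrow> 'b"
  assumes "smooth_manifold M"
    and "smooth_tensor_field M \<tau>"
    and "nondegenerate M \<tau>"
    and "smooth_manifold N"
    and "smooth_embedding N M \<phi>"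
    and "nondegenerate N (pullback_tensor N M \<phi> \<tau>)"
    and "point_reduction N M \<phi> \<rho>"
  shows "reduction_map N M \<phi> (gmg_reduction N M \<phi> \<tau> \<rho>)"
proof -
  interpret gmg M N \<tau> \<phi> \<rho>
    using assms by unfold_locales
      (simp_all add: smooth_embedding_def immersion_def point_reduction_def)
  show ?thesis by (rule reduction_map_gmg)
qed

end
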